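(* Let $d\geq 2$ be a natural number. Let $\Gamma=(U,V,E)$ be a highly computable bipartite graph such that: (1) both $U$ and $V$ are identified with (are disjoint copies of) $\mathbb{N}\setminus\{0\}$; (2) $E$ does not contain edges of the form $(u,v_u)$, where $v_u\in V$ is the copy of $u\in U$ (the same natural number); (3) $\Gamma$ is fully reflected; (4) $\Gamma$ satisfies the computable expanding Hall's harem condition with respect to $d$, $c.e.H.h.c.(d)$. Then there exists a computable perfect $(1,d-1)$-matching $M$ of $\Gamma$ which realizes a computable $(d-1)$ to $1$ function $f:\mathbb{N}\setminus\{0\}\to\mathbb{N}\setminus\{0\}$ with controlled sizes of its cycles.
   Context: A bipartite graph $\Gamma=(U,V,E)$ has vertex set the disjoint union of $U$ and $V$, and $E\subseteq U\times V$. For a vertex $x$, $N(x)$ is the set of vertices adjacent to $x$ (so $N(u)\subseteq V$ for $u\in U$ and $N(v)\subseteq U$ for $v\in V$), and $N(X)=\bigcup_{x\in X}N(x)$. With $U$ and $V$ copies of $\mathbb{N}\setminus\{0\}$: $u_v\in U$ denotes the copy of $v\in V$ and $v_u\in V$ the copy of $u\in U$ (same natural number). $\Gamma$ is fully reflected if for every $(u,v)\in E$ also $(u_v,v_u)\in E$. $\Gamma$ is highly computable if $E$ is a computable set of pairs, all $N(x)$ are finite, and the functions $u\mapsto|N(u)|$ ($u\in U$) and $v\mapsto|N(v)|$ ($v\in V$) are computable. $\Gamma$ satisfies $c.e.H.h.c.(k)$ if there is a total computable function $h:\mathbb{N}\to\mathbb{N}$ such that: $h(0)=0$; for all finite $X\subset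 U$ and all $n$, $h(n)\leq|X|$ implies $n\leq|N(X)|-k|X|$; for all finite $Y\subset V$ and all $n$, $h(n)\leq|Y|$ implies $n\leq|N(Y)|-\frac1k|Y|$. A perfect $(1,k)$-matching of $\Gamma$ is a set $M\subseteq E$ such that each $u\in U$ has exactly $k$ vertices $v\in V$ with $(u,v)\in M$, and each $v\in V$ has exactly one $u\in U$ with $(u,v)\in M$. It is computable if $M$ is a computable set of pairs. The function $f$ realized by $M$ is given by $f(v)=u$ iff $(u,v)\in M$ (elements of $U$ and $V$ viewed as natural numbers); it is $k$ to $1$, i.e. every value has exactly $k$ preimages. A $(d-1)$ to $1$ function $f$ has controlled sizes of its cycles if: (i) $f^2(1)=1$; (ii) for every $n\geq2$ that is a periodic point of $f$, the cycle of $n$ has length at most $n$, i.e. the least $i\ge 1$ with $f^i(n)=n$ satisfies $i\leq n$; (iii) if $n\geq2$ and $f^i(n)\neq n$ for all $1\le i\leq n$, then there exist $k\leq 2n$ and $1\le l\leq n$ such that $f^{k+l}(n)=f^k(n)$. *)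

theory Defs
  imports Complex_Main
begin

section \<open>Computable functions and relations\<close>

text \<open>
  The total recursive functions of each arity: the least class containing the zero, successor and
  projection functions and closed under composition, primitive recursion and minimisation of
  regular functions. By Kleene's normal form theorem these are exactly the total functions that are
  computable in any of the usual senses. In \<open>recursive_fn n f\<close> only the values of \<open>f\<close> on
  lists of length \<open>n\<close> are meaningful.
\<close>

inductive recursive_fn :: "nat \<Rightarrow> (nat list \<Rightarrow> nat) \<Rightarrow> bool" where
  zero: "recursive_fn n (\<lambda>xs. 0)"
| succ: "recursive_fn 1 (\<lambda>xs. Suc (xs ! 0))"
| proj: "i < n \<Longrightarrow> recursive_fn n (\<lambda>xs. xs ! i)"
| comp: "recursive_fn (length fs) g \<Longrightarrow> \<forall>f\<in>set fs. recursive_fn n f \<Longrightarrow>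
    recursive_fn n (\<lambda>xs. g (map (\<lambda>f. f xs) fs))"
| prim_rec: "recursive_fn n g \<Longrightarrow> recursive_fn (Suc (Suc n)) h \<Longrightarrow>
    recursive_fn (Suc n) (\<lambda>xs. rec_nat (g (tl xs)) (\<lambda>y r. h (y # r # tl xs)) (hd xs))"
| minimise: "recursive_fn (Suc n) g \<Longrightarrow> \<forall>xs. length xs = n \<longrightarrow> (\<exists>y. g (y # xs) = 0) \<Longrightarrow>
    recursive_fn n (\<lambda>xs. LEAST y. g (y # xs) = 0)"

text \<open>
  Functions on a subset \<open>A\<close> of the natural numbers are represented by functions on all natural
  numbers whose values outside \<open>A\<close> are irrelevant. Below \<open>A\<close> is \<open>UNIV\<close> or the set of
  positive numbers; for such decidable \<open>A\<close>, a function on \<open>A\<close> is computable iff it has a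
  total computable extension.
\<close>

definition computable_on :: "nat set \<Rightarrow> (nat \<Rightarrow> nat) \<Rightarrow> bool" where
  "computable_on A f \<longleftrightarrow> (\<exists>g. recursive_fn 1 g \<and> (\<forall>x\<in>A. f x = g [x]))"

definition computable_rel :: "(nat \<times> nat) set \<Rightarrow> bool" where
  "computable_rel R \<longleftrightarrow>
     (\<exists>g. recursive_fn 2 g \<and> (\<forall>x y. g [x, y] = (if (x, y) \<in> R then 1 else 0)))"


section \<open>Bipartite graphs\<close>

text \<open>
  The two sides of a graph are told apart by the position in the pairs belonging to \<open>E\<close>, so
  \<open>U\<close> and \<open>V\<close> may be the same set of numbers while playing the role of disjoint copies: the
  number \<open>n\<close> as first component is a vertex of \<open>U\<close>, as second component its copy in \<open>V\<close>.
\<close>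

definition bipartite_graph :: "'a set \<Rightarrow> 'b set \<Rightarrow> ('a \<times> 'b) set \<Rightarrow> bool" where
  "bipartite_graph U V E \<longleftrightarrow> E \<subseteq> U \<times> V"

text \<open>Neighbourhood of a set of vertices of the \<open>U\<close>-side and of the \<open>V\<close>-side, respectively.\<close>

definition nbhd_U :: "('a \<times> 'b) set \<Rightarrow> 'a set \<Rightarrow> 'b set" where
  "nbhd_U E X = {v. \<exists>u\<in>X. (u, v) \<in> E}"

definition nbhd_V :: "('a \<times> 'b) set \<Rightarrow> 'b set \<Rightarrow> 'a set" where
  "nbhd_V E Y = {u. \<exists>v\<in>Y. (u, v) \<in> E}"

definition fully_reflected :: "(nat \<times> nat) set \<Rightarrow> bool" where
  "fully_reflected E \<longleftrightarrow> (\<forall>u v. (u, v) \<in> E \<longrightarrow> (v, u) \<in> E)"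

definition highly_computable :: "nat set \<Rightarrow> nat set \<Rightarrow> (nat \<times> nat) set \<Rightarrow> bool" where
  "highly_computable U V E \<longleftrightarrow>
     computable_rel E \<and>
     (\<forall>u\<in>U. finite (nbhd_U E {u})) \<and>
     (\<forall>v\<in>V. finite (nbhd_V E {v})) \<and>
     computable_on U (\<lambda>u. card (nbhd_U E {u})) \<and>
     computable_on V (\<lambda>v. card (nbhd_V E {v}))"

text \<open>The computable expanding Hall's harem condition \<open>c.e.H.h.c.(k)\<close>.\<close>

definition cehhc :: "nat \<Rightarrow> 'a set \<Rightarrow> 'b set \<Rightarrow> ('a \<times> 'b) set \<Rightarrow> bool" where
  "cehhc k U V E \<longleftrightarrow>
     (\<exists>h. computable_on UNIV h \<and> h 0 = 0 \<and>
       (\<forall>X n. finite X \<and> X \<subseteq> U \<and> h n \<le> card X \<longrightarrow>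
          real n \<le> real (card (nbhd_U E X)) - real k * real (card X)) \<and>
       (\<forall>Y n. finite Y \<and> Y \<subseteq> V \<and> h n \<le> card Y \<longrightarrow>
          real n \<le> real (card (nbhd_V E Y)) - 1 / real k * real (card Y)))"

definition perfect_matching ::
    "nat \<Rightarrow> 'a set \<Rightarrow> 'b set \<Rightarrow> ('a \<times> 'b) set \<Rightarrow> ('a \<times> 'b) set \<Rightarrow> bool" where
  "perfect_matching k U V E M \<longleftrightarrow>
     M \<subseteq> E \<and>
     (\<forall>u\<in>U. finite {v\<in>V. (u, v) \<in> M} \<and> card {v\<in>V. (u, v) \<in> M} = k) \<and>
     (\<forall>v\<in>V. \<exists>!u. u \<in> U \<and> (u, v) \<in> M)"

definition realizes :: "'a set \<Rightarrow> 'b set \<Rightarrow> ('a \<times> 'b) set \<Rightarrow> ('b \<Rightarrow> 'a) \<Rightarrow> bool" where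
  "realizes U V M f \<longleftrightarrow> (\<forall>v\<in>V. \<forall>u\<in>U. f v = u \<longleftrightarrow> (u, v) \<in> M)"


section \<open>Functions with controlled sizes of cycles\<close>

definition k_to_one :: "nat \<Rightarrow> 'a set \<Rightarrow> 'b set \<Rightarrow> ('a \<Rightarrow> 'b) \<Rightarrow> bool" where
  "k_to_one k A B f \<longleftrightarrow>
     f ` A \<subseteq> B \<and> (\<forall>b\<in>B. finite {a\<in>A. f a = b} \<and> card {a\<in>A. f a = b} = k)"

definition periodic_point :: "('a \<Rightarrow> 'a) \<Rightarrow> 'a \<Rightarrow> bool" where
  "periodic_point f x \<longleftrightarrow> (\<exists>i\<ge>1. (f ^^ i) x = x)"

definition cycle_length :: "('a \<Rightarrow> 'a) \<Rightarrow> 'a \<Rightarrow> nat" where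
  "cycle_length f x = (LEAST i. 1 \<le> i \<and> (f ^^ i) x = x)"

definition controlled_cycles :: "(nat \<Rightarrow> nat) \<Rightarrow> bool" where
  "controlled_cycles f \<longleftrightarrow>
     (f ^^ 2) 1 = 1 \<and>
     (\<forall>n\<ge>2. periodic_point f n \<longrightarrow> cycle_length f n \<le> n) \<and>
     (\<forall>n\<ge>2. (\<forall>i. 1 \<le> i \<and> i \<le> n \<longrightarrow> (f ^^ i) n \<noteq> n) \<longrightarrow>
        (\<exists>k l. k \<le> 2 * n \<and> 1 \<le> l \<and> l \<le> n \<and> (f ^^ (k + l)) n = (f ^^ k) n))"

end

theory Submission
  imports Defs "HOL-Library.Nat_Bijection"
begin

text \<open>
  By \<open>c.e.H.h.c.(d)\<close> one computes a partial function \<open>p\<close> from \<open>V\<close> to \<open>U\<close>, the parent, such that every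
  \<open>u\<close> has exactly \<open>d\<close> children. It is built in stages that keep Hall's condition for the remaining
  graph; this condition is decidable because \<open>h\<close> bounds the size of a set that violates it.

  The function \<open>f\<close> uses only \<open>d - 1\<close> children of each vertex and closes all its orbits by cycles
  of length 2: for a child \<open>b\<close> of \<open>a\<close>, one may put \<open>f a = b\<close> and \<open>f b = a\<close>, as the graph is
  reflected. Then \<open>a\<close> needs \<open>d - 2\<close> further preimages and \<open>b\<close> needs \<open>d - 2\<close>, so that each vertex
  tolerates one child that has been assigned elsewhere. A finite piece of \<open>f\<close> is good if
  no vertex without preimages has two assigned children, and the vertices with one such child (the
  marked ones) are themselves unassigned and no two of them are parent and child. A good piece can
  be extended to contain any given vertex: a violation created at the parent of a new 2-cycle is
  repaired by making the two adjacent marked vertices a 2-cycle, which moves the violation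
  upwards and decreases the number of marked vertices. Each extension adds at most 2 to the number
  of steps needed to reach a 2-cycle.
\<close>

subsection \<open>Computability toolkit\<close>

text \<open>The parent map cannot serve as the function itself: it may be undefined somewhere, and
  following parents may never return or may run through long cycles. Reversing an edge helps with
  both, since a vertex without a parent can be sent to a child, but the parent of a redirected
  vertex loses a preimage. Asking for \<open>d\<close> children where \<open>d - 1\<close> are used
  pays for exactly one such loss per vertex. The graph of \<open>p\<close> need not have roots and
  may contain cycles, so no repair can rely on reaching a top. A repair ends because each 2-cycle
  removes two marks and creates at most one. The number of 2-cycles in a repair has no fixed bound,
  yet it does not enter the orbit lengths: vertices assigned around a new 2-cycle reach it in one
  step, those assigned in consequence in two. Only giving preimages to a vertex that was assigned
  earlier builds on long orbits. This happens at most once per extension and costs one step, plus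
  one for marked vertices that become assigned by it; this is the origin of the factor 2 in the
  bound \<open>2 * n\<close>.\<close>

definition tuple_computable :: "nat \<Rightarrow> (nat list \<Rightarrow> nat) \<Rightarrow> bool" where
  "tuple_computable n F \<longleftrightarrow> (\<exists>g. recursive_fn n g \<and> (\<forall>xs. length xs = n \<longrightarrow> g xs = F xs))"

text \<open>\<open>recursive_fn n\<close> speaks of functions on lists of every length, although
  only length \<open>n\<close> carries meaning. Working up to agreement on length \<open>n\<close>
  makes the notion stable under rewriting.\<close>

lemma tuple_cong: "tuple_computable n F \<Longrightarrow> (\<And>xs. length xs = n \<Longrightarrow> F xs = G xs) \<Longrightarrow> tuple_computable n G"
  unfolding tuple_computable_def by metis

lemma tuple_proj: "i < n \<Longrightarrow> tuple_computable n (\<lambda>xs. xs ! i)"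
  unfolding tuple_computable_def using recursive_fn.proj by blast

lemma tuple_comp1:
  assumes "tuple_computable 1 G" "tuple_computable n f"
  shows "tuple_computable n (\<lambda>xs. G [f xs])"
proof -
  obtain g f' where g: "recursive_fn 1 g" "\<forall>xs. length xs = 1 \<longrightarrow> g xs = G xs"
    and f: "recursive_fn n f'" "\<forall>xs. length xs = n \<longrightarrow> f' xs = f xs"
    using assms unfolding tuple_computable_def by blast
  have "recursive_fn n (\<lambda>xs. g (map (\<lambda>f. f xs) [f']))"
    by (rule recursive_fn.comp) (use g f in auto)
  then show ?thesis unfolding tuple_computable_def using g f by (intro exI conjI) auto
qed

lemma tuple_comp2:
  assumes "tuple_computable 2 G" "tuple_computable n a" "tuple_computable n b"
  shows "tuple_computable n (\<lambda>xs. G [a xs, b xs])"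
proof -
  obtain g a' b' where g: "recursive_fn 2 g" "\<forall>xs. length xs = 2 \<longrightarrow> g xs = G xs"
    and f: "recursive_fn n a'" "\<forall>xs. length xs = n \<longrightarrow> a' xs = a xs"
      "recursive_fn n b'" "\<forall>xs. length xs = n \<longrightarrow> b' xs = b xs"
    using assms unfolding tuple_computable_def by blast
  have "recursive_fn n (\<lambda>xs. g (map (\<lambda>f. f xs) [a', b']))"
    by (rule recursive_fn.comp) (use g f in \<open>auto simp: numeral_2_eq_2\<close>)
  then show ?thesis unfolding tuple_computable_def using g f by (intro exI conjI) auto
qed

lemma tuple_Suc: "tuple_computable n f \<Longrightarrow> tuple_computable n (\<lambda>xs. Suc (f xs))"
proof -
  have "tuple_computable 1 (\<lambda>xs. Suc (xs ! 0))"
    unfolding tuple_computable_def using recursive_fn.succ by blast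
  then show "tuple_computable n f \<Longrightarrow> tuple_computable n (\<lambda>xs. Suc (f xs))"
    using tuple_comp1 by fastforce
qed

lemma tuple_const: "tuple_computable n (\<lambda>xs. k)"
proof (induction k)
  case 0
  then show ?case unfolding tuple_computable_def using recursive_fn.zero by blast
next
  case (Suc k)
  then show ?case by (rule tuple_Suc)
qed

lemma tuple_rec:
  assumes "tuple_computable n G" "tuple_computable (Suc (Suc n)) H"
  shows "tuple_computable (Suc n) (\<lambda>xs. rec_nat (G (tl xs)) (\<lambda>y r. H (y # r # tl xs)) (hd xs))"
proof -
  obtain g h where g: "recursive_fn n g" "\<forall>xs. length xs = n \<longrightarrow> g xs = G xs"
    and h: "recursive_fn (Suc (Suc n)) h" "\<forall>xs. length xs = Suc (Suc n) \<longrightarrow> h xs = H xs"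
    using assms unfolding tuple_computable_def by blast
  have eq: "rec_nat (g (tl xs)) (\<lambda>y r. h (y # r # tl xs)) k = rec_nat (G (tl xs)) (\<lambda>y r. H (y # r # tl xs)) k"
    if "length xs = Suc n" for xs k
    using that g h by (induction k) auto
  show ?thesis
    unfolding tuple_computable_def using recursive_fn.prim_rec[OF g(1) h(1)] eq by blast
qed

lemma tuple_least:
  assumes "tuple_computable (Suc n) G" "\<And>xs. length xs = n \<Longrightarrow> \<exists>y. G (y # xs) = 0"
  shows "tuple_computable n (\<lambda>xs. LEAST y. G (y # xs) = 0)"
proof -
  obtain g where g: "recursive_fn (Suc n) g" "\<forall>xs. length xs = Suc n \<longrightarrow> g xs = G xs"
    using assms unfolding tuple_computable_def by blast
  have "recursive_fn n (\<lambda>xs. LEAST y. g (y # xs) = 0)"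
    by (rule recursive_fn.minimise) (use g assms in auto)
  then show ?thesis unfolding tuple_computable_def using g by (intro exI conjI) auto
qed

text \<open>One parameter is enough: the rule serves to obtain arithmetic and the pairing function,
  and from then on several parameters are packed into one number.\<close>

lemma tuple_rec2:
  assumes "tuple_computable 1 (\<lambda>xs. G (xs ! 0))" "tuple_computable 3 (\<lambda>xs. H (xs ! 0) (xs ! 1) (xs ! 2))" "tuple_computable n a" "tuple_computable n b"
  shows "tuple_computable n (\<lambda>xs. rec_nat (G (b xs)) (\<lambda>y r. H y r (b xs)) (a xs))"
proof -
  have "tuple_computable 2 (\<lambda>xs. rec_nat (G (tl xs ! 0)) (\<lambda>y r. H y r (tl xs ! 0)) (hd xs))"
    using tuple_rec[OF assms(1), of "\<lambda>xs. H (xs ! 0) (xs ! 1) (xs ! 2)"] assms(2)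
    by (simp add: numeral_2_eq_2 numeral_3_eq_3)
  from tuple_comp2[OF this assms(3,4)] show ?thesis by simp
qed

lemma tuple_add: "tuple_computable n a \<Longrightarrow> tuple_computable n b \<Longrightarrow> tuple_computable n (\<lambda>xs. a xs + b xs)"
proof -
  assume "tuple_computable n a" "tuple_computable n b"
  then have "tuple_computable n (\<lambda>xs. rec_nat (b xs) (\<lambda>y r. Suc r) (a xs))"
    by (intro tuple_rec2[where G = "\<lambda>x. x" and H = "\<lambda>y r x. Suc r"] tuple_Suc tuple_proj) auto
  moreover have "rec_nat k (\<lambda>y r. Suc r) m = m + k" for k m :: nat by (induction m) auto
  ultimately show ?thesis by simp
qed

lemma tuple_mult: "tuple_computable n a \<Longrightarrow> tuple_computable n b \<Longrightarrow> tuple_computable n (\<lambda>xs. a xs * b xs)"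
proof -
  assume "tuple_computable n a" "tuple_computable n b"
  then have "tuple_computable n (\<lambda>xs. rec_nat 0 (\<lambda>y r. r + b xs) (a xs))"
    by (intro tuple_rec2[where G = "\<lambda>x. 0" and H = "\<lambda>y r x. r + x"] tuple_add tuple_proj tuple_const) auto
  moreover have "rec_nat 0 (\<lambda>y r. r + k) m = m * k" for k m :: nat by (induction m) auto
  ultimately show ?thesis by simp
qed

lemma tuple_diff: "tuple_computable n a \<Longrightarrow> tuple_computable n b \<Longrightarrow> tuple_computable n (\<lambda>xs. a xs - b xs)"
proof -
  have pred: "tuple_computable n (\<lambda>xs. a xs - 1)" if a: "tuple_computable n a" for n a
  proof -
    have "tuple_computable n (\<lambda>xs. rec_nat 0 (\<lambda>y r. y) (a xs))"
      by (intro tuple_rec2[where G = "\<lambda>x. 0" and H = "\<lambda>y r x. y" and b = a] tuple_proj tuple_const a) auto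
    moreover have "rec_nat 0 (\<lambda>y r. y) m = m - 1" for m :: nat by (cases m) auto
    ultimately show ?thesis by simp
  qed
  assume "tuple_computable n a" "tuple_computable n b"
  then have "tuple_computable n (\<lambda>xs. rec_nat (a xs) (\<lambda>y r. r - 1) (b xs))"
    by (intro tuple_rec2[where G = "\<lambda>x. x" and H = "\<lambda>y r x. r - 1"] pred tuple_proj) auto
  moreover have "rec_nat k (\<lambda>y r. r - 1) m = k - m" for k m :: nat by (induction m) auto
  ultimately show ?thesis by simp
qed

lemma tuple_triangle: "tuple_computable n a \<Longrightarrow> tuple_computable n (\<lambda>xs. triangle (a xs))"
proof -
  assume a: "tuple_computable n a"
  have "tuple_computable n (\<lambda>xs. rec_nat 0 (\<lambda>y r. r + Suc y) (a xs))"
    by (intro tuple_rec2[where G = "\<lambda>x. 0" and H = "\<lambda>y r x. r + Suc y" and b = a] tuple_add tuple_Suc tuple_proj tuple_const a) auto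
  moreover have "rec_nat 0 (\<lambda>y r. r + Suc y) m = triangle m" for m :: nat
    by (induction m) auto
  ultimately show ?thesis by simp
qed

section \<open>Coding of pairs and unary computable functions\<close>

abbreviation pair :: "nat \<Rightarrow> nat \<Rightarrow> nat" where "pair x y \<equiv> prod_encode (x, y)"
definition pfst :: "nat \<Rightarrow> nat" where "pfst e = fst (prod_decode e)"
definition psnd :: "nat \<Rightarrow> nat" where "psnd e = snd (prod_decode e)"

lemma pfst_pair [simp]: "pfst (pair x y) = x" and psnd_pair [simp]: "psnd (pair x y) = y"
  by (simp_all add: pfst_def psnd_def)

lemma pair_pfst_psnd [simp]: "pair (pfst e) (psnd e) = e"
  by (simp add: pfst_def psnd_def)

lemma tuple_pair: "tuple_computable n a \<Longrightarrow> tuple_computable n b \<Longrightarrow> tuple_computable n (\<lambda>xs. pair (a xs) (b xs))"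
  by (simp add: prod_encode_def tuple_add tuple_triangle)

lemma triangle_mono: "m \<le> n \<Longrightarrow> triangle m \<le> triangle n"
  by (induction n) (auto simp: le_Suc_eq)

text \<open>The code of \<open>(x, y)\<close> is \<open>triangle (x + y) + x\<close>, so the search
  finds the diagonal on which \<open>e\<close> lies. Decoding is thereby reduced to minimisation and
  subtraction.\<close>

lemma triangle_root: "(LEAST s. e < triangle (Suc s)) = pfst e + psnd e"
proof (rule Least_equality)
  have e: "e = triangle (pfst e + psnd e) + pfst e"
    using pair_pfst_psnd[of e] unfolding prod_encode_def by simp
  then show "e < triangle (Suc (pfst e + psnd e))" by simp
  fix s assume s: "e < triangle (Suc s)"
  show "pfst e + psnd e \<le> s"
  proof (rule ccontr)
    assume "\<not> pfst e + psnd e \<le> s"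
    then have "triangle (Suc s) \<le> triangle (pfst e + psnd e)"
      by (intro triangle_mono) simp
    with s e show False by simp
  qed
qed

lemma tuple_root: "tuple_computable n a \<Longrightarrow> tuple_computable n (\<lambda>xs. pfst (a xs) + psnd (a xs))"
proof -
  \<comment> \<open>Truncated subtraction turns the inequality \<open>e < triangle (Suc s)\<close>
    into the zero test that \<open>minimise\<close> works with.\<close>
  have "tuple_computable 1 (\<lambda>xs. LEAST s. (\<lambda>xs. Suc (xs ! 1) - triangle (Suc (xs ! 0))) (s # xs) = 0)"
  proof (rule tuple_least)
    show "tuple_computable (Suc 1) (\<lambda>xs. Suc (xs ! 1) - triangle (Suc (xs ! 0)))"
      by (intro tuple_diff tuple_Suc tuple_triangle tuple_proj) auto
    fix xs :: "nat list" assume "length xs = 1"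
    have "n \<le> triangle n" for n by (induction n) auto
    then have "Suc (xs ! 0) \<le> triangle (Suc (xs ! 0))" by blast
    then show "\<exists>y. Suc ((y # xs) ! 1) - triangle (Suc ((y # xs) ! 0)) = 0"
      by (intro exI[of _ "xs ! 0"]) simp
  qed
  then have "tuple_computable 1 (\<lambda>xs. pfst (xs ! 0) + psnd (xs ! 0))"
    by (simp add: triangle_root[symmetric] less_Suc_eq_le)
  then show "tuple_computable n a \<Longrightarrow> tuple_computable n (\<lambda>xs. pfst (a xs) + psnd (a xs))"
    using tuple_comp1 by fastforce
qed

lemma tuple_pfst: "tuple_computable n a \<Longrightarrow> tuple_computable n (\<lambda>xs. pfst (a xs))"
proof (rule tuple_cong)
  show "tuple_computable n a \<Longrightarrow> tuple_computable n (\<lambda>xs. a xs - triangle (pfst (a xs) + psnd (a xs)))"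
    by (intro tuple_diff tuple_triangle tuple_root)
  fix xs
  have "a xs = triangle (pfst (a xs) + psnd (a xs)) + pfst (a xs)"
    using pair_pfst_psnd[of "a xs"] unfolding prod_encode_def by simp
  then show "a xs - triangle (pfst (a xs) + psnd (a xs)) = pfst (a xs)" by simp
qed

lemma tuple_psnd: "tuple_computable n a \<Longrightarrow> tuple_computable n (\<lambda>xs. psnd (a xs))"
  using tuple_diff[OF tuple_root tuple_pfst, of n a a] by simp

text \<open>Unary functions suffice from here on. In the rules below a bound variable and its
  context \<open>e\<close> are the components of one code \<open>z\<close>, so that every premise is
  again about a unary function.\<close>

definition computable :: "(nat \<Rightarrow> nat) \<Rightarrow> bool" where
  "computable f \<longleftrightarrow> tuple_computable 1 (\<lambda>xs. f (xs ! 0))"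

lemma computable_iff_computable_on: "computable f \<longleftrightarrow> computable_on UNIV f"
proof
  assume "computable f"
  then obtain g where "recursive_fn 1 g" "\<forall>xs. length xs = 1 \<longrightarrow> g xs = f (xs ! 0)"
    unfolding computable_def tuple_computable_def by blast
  then show "computable_on UNIV f"
    unfolding computable_on_def by (metis length_Cons list.size(3) nth_Cons_0 One_nat_def)
next
  assume "computable_on UNIV f"
  then obtain g where "recursive_fn 1 g" "\<forall>x. f x = g [x]"
    unfolding computable_on_def by blast
  then show "computable f"
    unfolding computable_def tuple_computable_def
      by (auto simp: length_Suc_conv intro!: exI[of _ g])
qed

lemma computable_cong: "computable f \<Longrightarrow> (\<And>e. f e = g e) \<Longrightarrow> computable g"
  by (subgoal_tac "f = g") auto

lemma computable_comp: "computable f \<Longrightarrow> computable a \<Longrightarrow> computable (\<lambda>e. f (a e))"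
  unfolding computable_def using tuple_comp1[of "\<lambda>xs. f (xs ! 0)" 1 "\<lambda>xs. a (xs ! 0)"]
    by simp

lemma computable_tuple2: "tuple_computable 2 (\<lambda>xs. F (xs ! 0) (xs ! 1)) \<Longrightarrow> computable a \<Longrightarrow> computable b \<Longrightarrow> computable (\<lambda>e. F (a e) (b e))"
  unfolding computable_def using tuple_comp2[of "\<lambda>xs. F (xs ! 0) (xs ! 1)" 1 "\<lambda>xs. a (xs ! 0)" "\<lambda>xs. b (xs ! 0)"]
  by simp

lemma tuple2_computable:
  assumes "computable (\<lambda>e. F (pfst e) (psnd e))"
  shows "tuple_computable 2 (\<lambda>xs. F (xs ! 0) (xs ! 1))"
proof -
  have "tuple_computable 2 (\<lambda>xs. pair (xs ! 0) (xs ! 1))"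
    by (intro tuple_pair tuple_proj) auto
  from tuple_comp1[OF assms[unfolded computable_def] this] show ?thesis by simp
qed

named_theorems computable_intros

lemma computable_id [computable_intros]: "computable (\<lambda>e. e)" unfolding computable_def
  by (intro tuple_proj) simp
lemma computable_const [computable_intros]: "computable (\<lambda>e. k)" unfolding computable_def
  by (rule tuple_const)
lemma computable_Suc [computable_intros]: "computable a \<Longrightarrow> computable (\<lambda>e. Suc (a e))"
  unfolding computable_def by (rule tuple_Suc)
lemma computable_add [computable_intros]: "computable a \<Longrightarrow> computable b \<Longrightarrow> computable (\<lambda>e. a e + b e)"
  unfolding computable_def by (rule tuple_add)
lemma computable_mult [computable_intros]: "computable a \<Longrightarrow> computable b \<Longrightarrow> computable (\<lambda>e. a e * b e)"
  unfolding computable_def by (rule tuple_mult)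
lemma computable_diff [computable_intros]: "computable a \<Longrightarrow> computable b \<Longrightarrow> computable (\<lambda>e. a e - b e)"
  unfolding computable_def by (rule tuple_diff)
lemma computable_pair [computable_intros]: "computable a \<Longrightarrow> computable b \<Longrightarrow> computable (\<lambda>e. pair (a e) (b e))"
  unfolding computable_def by (rule tuple_pair)
lemma computable_pfst [computable_intros]: "computable a \<Longrightarrow> computable (\<lambda>e. pfst (a e))"
  unfolding computable_def by (rule tuple_pfst)
lemma computable_psnd [computable_intros]: "computable a \<Longrightarrow> computable (\<lambda>e. psnd (a e))"
  unfolding computable_def by (rule tuple_psnd)

text \<open>The code \<open>z\<close> consists of the counter, the previous value and the parameter,
  in this order.\<close>

lemma computable_rec [computable_intros]:
  assumes a: "computable a" and k: "computable k" and G: "computable (\<lambda>z. G (psnd (psnd z)) (pfst z) (pfst (psnd z)))"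
  shows "computable (\<lambda>e. rec_nat (a e) (\<lambda>y r. G e y r) (k e))"
proof -
  have p: "tuple_computable 3 (\<lambda>xs. pair (xs ! 0) (pair (xs ! 1) (xs ! 2)))"
    by (intro tuple_pair tuple_proj) auto
  have "tuple_computable 3 (\<lambda>xs. G (xs ! 2) (xs ! 0) (xs ! 1))"
    using tuple_comp1[OF G[unfolded computable_def] p] by simp
  then have "tuple_computable 1 (\<lambda>xs. rec_nat (a (xs ! 0)) (\<lambda>y r. G (xs ! 0) y r) (k (xs ! 0)))"
    by (intro tuple_rec2[where H = "\<lambda>y r x. G x y r"] a[unfolded computable_def] k[unfolded computable_def] tuple_proj) auto
  then show ?thesis unfolding computable_def .
qed

section \<open>Decidable predicates, bounded quantifiers and bounded counting\<close>

definition decidable :: "(nat \<Rightarrow> bool) \<Rightarrow> bool" where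
  "decidable P \<longleftrightarrow> computable (\<lambda>e. if P e then 1 else 0)"

lemma computable_least [computable_intros]:
  assumes P: "decidable (\<lambda>z. P (psnd z) (pfst z))" and ex: "\<And>e. \<exists>y. P e y"
  shows "computable (\<lambda>e. LEAST y. P e y)"
proof -
  have "computable (\<lambda>e. 1 - (if P (psnd e) (pfst e) then 1 else 0))"
    using P unfolding decidable_def by (intro computable_intros)
  from tuple2_computable[OF this] have "tuple_computable (Suc 1) (\<lambda>xs. 1 - (if P (xs ! 1) (xs ! 0) then 1 else 0))"
    by (simp add: numeral_2_eq_2)
  then have "tuple_computable 1 (\<lambda>xs. LEAST y. (\<lambda>xs. 1 - (if P (xs ! 1) (xs ! 0) then 1 else 0)) (y # xs) = (0::nat))"
    by (rule tuple_least) (use ex in auto)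
  moreover have "((1::nat) - (if Q then 1 else 0) = 0) = Q" for Q by simp
  ultimately show ?thesis unfolding computable_def by simp
qed

lemma decidable_not [computable_intros]:
  assumes "decidable P"
  shows "decidable (\<lambda>e. \<not> P e)"
  unfolding decidable_def
  by (rule computable_cong[OF computable_diff[OF computable_const assms[unfolded decidable_def]], of 1]) simp

lemma decidable_conj [computable_intros]:
  assumes "decidable P" "decidable Q"
  shows "decidable (\<lambda>e. P e \<and> Q e)"
  unfolding decidable_def
  by (rule computable_cong[OF computable_mult[OF assms[unfolded decidable_def]]]) simp

lemma decidable_disj [computable_intros]: "decidable P \<Longrightarrow> decidable Q \<Longrightarrow> decidable (\<lambda>e. P e \<or> Q e)"
proof -
  assume "decidable P" "decidable Q"
  then have "decidable (\<lambda>e. \<not> (\<not> P e \<and> \<not> Q e))"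
    by (rule decidable_not[OF decidable_conj[OF decidable_not decidable_not]])
  then show ?thesis by simp
qed

lemma decidable_imp [computable_intros]: "decidable P \<Longrightarrow> decidable Q \<Longrightarrow> decidable (\<lambda>e. P e \<longrightarrow> Q e)"
proof -
  assume "decidable P" "decidable Q"
  then have "decidable (\<lambda>e. \<not> P e \<or> Q e)"
    by (rule decidable_disj[OF decidable_not])
  then show ?thesis by simp
qed

lemma decidable_le [computable_intros]:
  assumes "computable a" "computable b"
  shows "decidable (\<lambda>e. a e \<le> b e)"
  unfolding decidable_def
  by (rule computable_cong[OF computable_diff[OF computable_const computable_diff[OF assms]], of 1]) simp

lemma decidable_less [computable_intros]: "computable a \<Longrightarrow> computable b \<Longrightarrow> decidable (\<lambda>e. a e < b e)"
proof -
  assume "computable a" "computable b"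
  then have "decidable (\<lambda>e. \<not> b e \<le> a e)" by (intro decidable_not decidable_le)
  then show ?thesis by (simp add: not_le)
qed

lemma decidable_eq [computable_intros]: "computable a \<Longrightarrow> computable b \<Longrightarrow> decidable (\<lambda>e. a e = b e)"
proof -
  assume "computable a" "computable b"
  then have "decidable (\<lambda>e. a e \<le> b e \<and> b e \<le> a e)"
    by (intro decidable_conj decidable_le)
  then show ?thesis by (simp add: eq_iff)
qed

lemma computable_if [computable_intros]:
  assumes "decidable P" "computable a" "computable b"
  shows "computable (\<lambda>e. if P e then a e else b e)"
  by (rule computable_cong[OF computable_add[OF computable_mult[OF assms(1)[unfolded decidable_def] assms(2)]
        computable_mult[OF decidable_not[OF assms(1), unfolded decidable_def] assms(3)]]]) simp

lemma computable_sum [computable_intros]: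
  assumes "computable b" "computable (\<lambda>z. F (psnd z) (pfst z))"
  shows "computable (\<lambda>e. \<Sum>i<b e. F e i)"
proof -
  have eq: "rec_nat 0 (\<lambda>i r. r + F e i) k = (\<Sum>i<k. F e i)" for e k
    by (induction k) auto
  have "computable (\<lambda>e. rec_nat 0 (\<lambda>i r. r + F e i) (b e))"
    using computable_comp[OF assms(2), of "\<lambda>z. pair (pfst z) (psnd (psnd z))"]
    by (intro computable_intros assms(1)) (simp add: computable_intros)
  then show ?thesis unfolding eq .
qed

lemma decidable_bex [computable_intros]:
  assumes "computable b" "decidable (\<lambda>z. P (psnd z) (pfst z))"
  shows "decidable (\<lambda>e. \<exists>i<b e. P e i)"
proof -
  have "computable (\<lambda>e. \<Sum>i<b e. if P e i then 1 else 0)"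
    using assms unfolding decidable_def by (rule computable_sum)
  then have "decidable (\<lambda>e. (\<Sum>i<b e. if P e i then 1 else 0) \<noteq> (0::nat))"
    by (intro decidable_not decidable_eq computable_const)
  moreover have "((\<Sum>i<b e. if P e i then 1 else 0) \<noteq> (0::nat)) = (\<exists>i<b e. P e i)" for e
    by auto
  ultimately show ?thesis by simp
qed

lemma decidable_ball [computable_intros]:
  assumes "computable b" "decidable (\<lambda>z. P (psnd z) (pfst z))"
  shows "decidable (\<lambda>e. \<forall>i<b e. P e i)"
proof -
  have "decidable (\<lambda>e. \<not> (\<exists>i<b e. \<not> P e i))"
    by (intro decidable_not decidable_bex assms)
  then show ?thesis by simp
qed

lemma computable_card [computable_intros]:
  assumes "computable b" "decidable (\<lambda>z. P (psnd z) (pfst z))"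
  shows "computable (\<lambda>e. card {i. i < b e \<and> P e i})"
proof -
  have "computable (\<lambda>e. \<Sum>i<b e. if P e i then 1 else 0)"
    using assms unfolding decidable_def by (rule computable_sum)
  moreover have "(\<Sum>i<b e. if P e i then 1 else 0) = card {i. i < b e \<and> P e i}" for e
    by (simp add: sum.If_cases Int_def)
  ultimately show ?thesis by simp
qed

lemma computable_power [computable_intros]: "computable a \<Longrightarrow> computable b \<Longrightarrow> computable (\<lambda>e. a e ^ b e)"
proof -
  have eq: "rec_nat 1 (\<lambda>y r. r * x) k = x ^ k" for x k :: nat by (induction k) auto
  assume "computable a" "computable b"
  then have "computable (\<lambda>e. rec_nat 1 (\<lambda>y r. r * a e) (b e))"
    by - (assumption | rule computable_intros computable_comp[of a])+
  then show ?thesis unfolding eq .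
qed

lemma computable_funpow [computable_intros]:
  assumes "computable k" "computable a" "computable (\<lambda>z. F (psnd z) (pfst z))"
  shows "computable (\<lambda>e. ((F e) ^^ k e) (a e))"
proof -
  have eq: "rec_nat x (\<lambda>y r. F e r) n = ((F e) ^^ n) x" for e n x by (induction n) auto
  have "computable (\<lambda>e. rec_nat (a e) (\<lambda>y r. F e r) (k e))"
    using computable_comp[OF assms(3), of "\<lambda>z. pair (pfst (psnd z)) (psnd (psnd z))"]
    by (intro computable_intros assms(1,2)) (simp add: computable_intros)
  then show ?thesis unfolding eq .
qed

lemma decidable_set_decode [computable_intros]: "computable a \<Longrightarrow> computable b \<Longrightarrow> decidable (\<lambda>e. a e \<in> set_decode (b e))"
proof -
  \<comment> \<open>Membership is the parity of a quotient by \<open>2^a\<close>; a bounded search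
    for an odd quotient and a remainder expresses it by the rules at hand.\<close>
  have eq: "(a \<in> set_decode b) \<longleftrightarrow> (\<exists>q<Suc b. \<exists>r<2^a. b = (2 * q + 1) * 2^a + r)" for a b :: nat
  proof
    assume "a \<in> set_decode b"
    then have "odd (b div 2^a)" by (simp add: set_decode_def)
    then obtain q where q: "b div 2^a = 2 * q + 1" by (elim oddE)
    have "b = (2 * q + 1) * 2^a + b mod 2^a"
      using div_mult_mod_eq[of b "2^a"] q by simp
    moreover have "q \<le> b" using q div_le_dividend[of b "2^a"] by linarith
    ultimately show "\<exists>q<Suc b. \<exists>r<2^a. b = (2 * q + 1) * 2^a + r"
      by (intro exI[of _ q] conjI exI[of _ "b mod 2^a"]) auto
  next
    assume "\<exists>q<Suc b. \<exists>r<2^a. b = (2 * q + 1) * 2^a + r"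
    then obtain q r where "r < 2^a" "b = r + (2 * q + 1) * 2^a" by auto
    then have "b div 2^a = 2 * q + 1"
      by (simp only: div_mult_self1) simp
    then show "a \<in> set_decode b" by (simp add: set_decode_def)
  qed
  assume "computable a" "computable b"
  then show ?thesis unfolding eq
    by - (assumption | rule computable_intros computable_comp[of a] computable_comp[of b])+
qed

section \<open>Finite functions coded by numbers, and limits of stages\<close>

text \<open>A finite function is coded by the bit set of the numbers
  \<open>pair value argument\<close>, with value \<open>0\<close> for undefined. The sum makes every
  \<open>t\<close> the code of some function, even if its set relates an argument to several values.
  The range \<open>u < t\<close> loses nothing, because the members of \<open>set_decode t\<close>
  are smaller than \<open>t\<close>.\<close>

definition lookup :: "nat \<Rightarrow> nat \<Rightarrow> nat" where
  "lookup t v = (\<Sum>u<t. if pair u v \<in> set_decode t then u else 0)"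

lemma computable_lookup [computable_intros]: "computable a \<Longrightarrow> computable b \<Longrightarrow> computable (\<lambda>e. lookup (a e) (b e))"
  unfolding lookup_def by (assumption | rule computable_intros computable_comp[of a] computable_comp[of b])+

lemma set_decode_less: "x \<in> set_decode t \<Longrightarrow> x < t"
proof -
  assume "x \<in> set_decode t"
  then have "2 ^ x \<le> t"
    by (metis div_less not_le even_zero mem_Collect_eq set_decode_def)
  then show ?thesis using less_exp[of x] by linarith
qed

text \<open>A code bounds the support of its function; this later turns quantifiers over assigned
  vertices into bounded ones.\<close>

lemma lookup_outside: "t \<le> v \<Longrightarrow> lookup t v = 0"
proof -
  assume "t \<le> v"
  moreover have "v \<le> pair u v" for u by (rule le_prod_encode_2)
  ultimately have "pair u v \<notin> set_decode t" for u
    using set_decode_less by (metis leD le_trans)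
  then show ?thesis by (simp add: lookup_def)
qed

lemma lookup_less: "lookup t v \<noteq> 0 \<Longrightarrow> v < t"
  using lookup_outside not_less by blast

lemma lookup_surj:
  assumes "finite {v. f v \<noteq> (0::nat)}"
  shows "\<exists>t. lookup t = f"
proof -
  define S where "S = (\<lambda>v. pair (f v) v) ` {v. f v \<noteq> 0}"
  define t where "t = set_encode S"
  have "finite S" unfolding S_def using assms by simp
  then have d: "set_decode t = S" unfolding t_def by (rule set_encode_inverse)
  have mem: "pair u v \<in> S \<longleftrightarrow> u = f v \<and> f v \<noteq> 0" for u v
    unfolding S_def by auto
  have "lookup t v = f v" for v
  proof (cases "f v = 0")
    case False
    then have "pair (f v) v < t" using d mem set_decode_less by blast
    then have "f v < t" using le_prod_encode_1[of "f v" v] by simp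
    moreover have "lookup t v = (\<Sum>u<t. if u = f v then u else 0)"
      unfolding lookup_def d mem using False by (intro sum.cong) auto
    ultimately show ?thesis by simp
  qed (simp add: lookup_def d mem)
  then show ?thesis by blast
qed

definition extends :: "(nat \<Rightarrow> nat) \<Rightarrow> (nat \<Rightarrow> nat) \<Rightarrow> bool" where
  "extends f g \<longleftrightarrow> (\<forall>v. f v \<noteq> 0 \<longrightarrow> g v = f v)"

lemma extends_refl [simp]: "extends f f" by (simp add: extends_def)
lemma extends_trans: "extends f g \<Longrightarrow> extends g h \<Longrightarrow> extends f h"
  by (auto simp: extends_def)

text \<open>Since \<open>minimise\<close> needs a total search, the search is made vacuous at numbers outside the
  invariant; this is why the invariant has to be decidable.\<close>

lemma computable_limit:
  assumes decidable: "decidable (\<lambda>e. Inv (pfst e) (lookup (psnd e)))"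
    and start: "finite {v. f0 v \<noteq> 0}" "Inv 0 f0"
    and step: "\<And>n f. finite {v. f v \<noteq> 0} \<Longrightarrow> Inv n f \<Longrightarrow>
      \<exists>g. finite {v. g v \<noteq> 0} \<and> extends f g \<and> Inv (Suc n) g"
    and total: "\<And>n f v. Inv n f \<Longrightarrow> 0 < v \<Longrightarrow> v \<le> n \<Longrightarrow> f v \<noteq> 0"
    and zero: "\<And>n f. Inv n f \<Longrightarrow> f 0 = 0"
  shows "\<exists>\<phi> F. computable \<phi> \<and> (\<forall>n. finite {v. F n v \<noteq> 0} \<and> Inv n (F n) \<and> extends (F n) \<phi> \<and> extends (F n) (F (Suc n)))"
proof -
  define Q where "Q n s t \<longleftrightarrow> (Inv n (lookup s) \<longrightarrow> Inv (Suc n) (lookup t) \<and> (\<forall>v<s. lookup s v \<noteq> 0 \<longrightarrow> lookup t v = lookup s v))" for n s t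
  have fin: "finite {v. lookup s v \<noteq> 0}" for s
    by (rule finite_subset[of _ "{..<s}"]) (use lookup_less in blast)+
  have ex: "\<exists>t. Q n s t" for n s
  proof (cases "Inv n (lookup s)")
    case True
    then obtain g where g: "finite {v. g v \<noteq> 0}" "extends (lookup s) g" "Inv (Suc n) g"
      using step fin by blast
    then obtain t where "lookup t = g" using lookup_surj by blast
    with g show ?thesis unfolding Q_def extends_def by auto
  qed (auto simp: Q_def)
  obtain s0 where s0: "lookup s0 = f0" using lookup_surj start by blast
  define \<sigma> where "\<sigma> n = rec_nat s0 (\<lambda>n r. LEAST t. Q n r t) n" for n
  have Inv: "computable a \<Longrightarrow> computable b \<Longrightarrow> decidable (\<lambda>e. Inv (a e) (lookup (b e)))" for a b
    using computable_comp[OF decidable[unfolded decidable_def], of "\<lambda>e. pair (a e) (b e)"]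
      by (simp add: computable_intros decidable_def)
  have decidable_Q: "decidable (\<lambda>e. Q (a e) (b e) (c e))" if "computable a" "computable b" "computable c" for a b c
    unfolding Q_def by (assumption | rule that computable_intros Inv computable_comp[of a] computable_comp[of b] computable_comp[of c])+
  have \<sigma>: "computable \<sigma>"
    unfolding \<sigma>_def by (rule computable_intros decidable_Q ex)+
  have Q: "Q n (\<sigma> n) (\<sigma> (Suc n))" for n
    unfolding \<sigma>_def using LeastI_ex[OF ex] by simp
  have I: "Inv n (lookup (\<sigma> n))" for n
  proof (induction n)
    case 0
    then show ?case using start s0 by (simp add: \<sigma>_def)
  next
    case (Suc n)
    then show ?case using Q[of n] by (simp add: Q_def)
  qed
  have E: "extends (lookup (\<sigma> n)) (lookup (\<sigma> (Suc n)))" for n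
    using Q[of n] I[of n] lookup_less unfolding Q_def extends_def by blast
  have E': "extends (lookup (\<sigma> n)) (lookup (\<sigma> (n + k)))" for n k
    by (induction k) (auto intro: extends_trans E)
  \<comment> \<open>By \<open>total\<close>, a number \<open>v > 0\<close> has its value at stage
    \<open>v\<close>, and later stages keep it, so the diagonal is the limit.\<close>
  define \<phi> where "\<phi> v = lookup (\<sigma> v) v" for v
  have "extends (lookup (\<sigma> n)) \<phi>" for n
  proof -
    have "\<phi> v = lookup (\<sigma> n) v" if v: "lookup (\<sigma> n) v \<noteq> 0" for v
    proof (cases "n \<le> v")
      case True
      with E'[of n "v - n"] v show ?thesis by (simp add: \<phi>_def extends_def)
    next
      case False
      have "v \<noteq> 0" using v zero[OF I] by metis
      then have "lookup (\<sigma> v) v \<noteq> 0" using total[OF I] by blast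
      with E'[of v "n - v"] False show ?thesis by (simp add: \<phi>_def extends_def)
    qed
    then show ?thesis by (simp add: extends_def)
  qed
  moreover have "computable \<phi>" unfolding \<phi>_def by (intro computable_intros \<sigma>)
  ultimately show ?thesis using I E fin
    by (intro exI[of _ \<phi>] exI[of _ "\<lambda>n. lookup (\<sigma> n)"]) blast
qed

subsection \<open>Computable one-sided matchings\<close>

definition nbs :: "('a \<Rightarrow> 'b set) \<Rightarrow> 'a set \<Rightarrow> 'b set" where
  "nbs N X = (\<Union>x\<in>X. N x)"

text \<open>\<open>B\<close> will be the set of decided vertices and \<open>c\<close> the number of
  children still missing, so that one notion covers all stages of the construction.\<close>

definition hall :: "('a \<Rightarrow> 'b set) \<Rightarrow> ('a \<Rightarrow> nat) \<Rightarrow> 'b set \<Rightarrow> bool" where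
  "hall N c B \<longleftrightarrow> (\<forall>X. finite X \<longrightarrow> sum c X \<le> card (nbs N X - B))"

definition tight :: "('a \<Rightarrow> 'b set) \<Rightarrow> ('a \<Rightarrow> nat) \<Rightarrow> 'b set \<Rightarrow> 'a set \<Rightarrow> bool" where
  "tight N c B X \<longleftrightarrow> finite X \<and> sum c X = card (nbs N X - B)"

lemma nbs_Un [simp]: "nbs N (X \<union> Y) = nbs N X \<union> nbs N Y"
  and nbs_insert [simp]: "nbs N (insert x X) = N x \<union> nbs N X"
  and nbs_empty [simp]: "nbs N {} = {}"
  by (auto simp: nbs_def)

lemma nbs_mono: "X \<subseteq> Y \<Longrightarrow> nbs N X \<subseteq> nbs N Y"
  by (auto simp: nbs_def)

context
  fixes N :: "'a \<Rightarrow> 'b set" and c :: "'a \<Rightarrow> nat" and B :: "'b set"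
  assumes fin: "\<And>x. finite (N x)" and hall: "hall N c B"
begin

lemma hallD: "finite X \<Longrightarrow> sum c X \<le> card (nbs N X - B)"
  using hall by (simp add: hall_def)

lemma finite_nbs: "finite X \<Longrightarrow> finite (nbs N X)"
  using fin by (simp add: nbs_def)

text \<open>The excess \<open>card (nbs N X - B) - sum c X\<close> is submodular and never negative.
  If it vanishes for two sets, it vanishes for their union and intersection, and equality must hold
  for the neighbourhoods as well.\<close>

lemma tight_Un_Int:
  assumes X: "tight N c B X" and Y: "tight N c B Y"
  shows "tight N c B (X \<union> Y)" "tight N c B (X \<inter> Y)"
    "nbs N (X \<inter> Y) - B = (nbs N X - B) \<inter> (nbs N Y - B)"
proof -
  have fX: "finite X" "finite Y" using X Y by (auto simp: tight_def)
  let ?a = "nbs N X - B" and ?b = "nbs N Y - B"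
  have f: "finite ?a" "finite ?b" using fX finite_nbs by auto
  have sub: "nbs N (X \<inter> Y) - B \<subseteq> ?a \<inter> ?b" by (auto simp: nbs_def)
  have 1: "card (?a \<union> ?b) + card (?a \<inter> ?b) = card ?a + card ?b"
    using card_Un_Int[OF f] by simp
  have 2: "sum c (X \<union> Y) + sum c (X \<inter> Y) = sum c X + sum c Y"
    by (rule sum.union_inter[OF fX])
  have 3: "nbs N (X \<union> Y) - B = ?a \<union> ?b" by auto
  have 4: "sum c (X \<union> Y) \<le> card (?a \<union> ?b)" using hallD[of "X \<union> Y"] fX 3
    by simp
  have 5: "sum c (X \<inter> Y) \<le> card (nbs N (X \<inter> Y) - B)"
    using hallD[of "X \<inter> Y"] fX by simp
  have 6: "card (nbs N (X \<inter> Y) - B) \<le> card (?a \<inter> ?b)" using sub f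
    by (intro card_mono) auto
  have 7: "sum c X = card ?a" "sum c Y = card ?b" using X Y by (auto simp: tight_def)
  have eq: "sum c (X \<union> Y) = card (?a \<union> ?b)" "sum c (X \<inter> Y) = card (nbs N (X \<inter> Y) - B)"
    "card (nbs N (X \<inter> Y) - B) = card (?a \<inter> ?b)"
    using 1 2 4 5 6 7 by linarith+
  show "tight N c B (X \<union> Y)" using eq(1) fX 3 by (simp add: tight_def)
  show "tight N c B (X \<inter> Y)" using eq(2) fX by (simp add: tight_def)
  show "nbs N (X \<inter> Y) - B = ?a \<inter> ?b"
    using sub f eq(3) by (intro card_subset_eq) auto
qed

lemma card_nbs_insert:
  assumes "finite X"
  shows "card (nbs N X - insert v B) = (if v \<in> nbs N X - B then card (nbs N X - B) - 1 else card (nbs N X - B))"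
proof -
  have "nbs N X - insert v B = (nbs N X - B) - {v}" by auto
  then show ?thesis using finite_nbs[OF assms] by simp
qed

text \<open>Using up one vertex costs a set at most one neighbour, so only a set without slack can
  fail, and only if it sees that vertex.\<close>

lemma violator_root:
  assumes X: "finite X" "\<not> sum c X \<le> card (nbs N X - insert v B)"
  shows "tight N c B X \<and> v \<in> nbs N X"
  using X hallD[OF X(1)] card_nbs_insert[OF X(1), of v] by (auto simp: tight_def split: if_splits)

text \<open>A set containing \<open>u\<close> loses at most one neighbour, but also one unit of
  demand, so it cannot fail.\<close>

lemma violator_edge:
  assumes u: "c u > 0"
    and X: "finite X" "\<not> sum (c(u := c u - 1)) X \<le> card (nbs N X - insert v B)"
  shows "u \<notin> X \<and> tight N c B X \<and> v \<in> nbs N X"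
proof (cases "u \<in> X")
  case True
  have "sum (c(u := c u - 1)) X = (c u - 1) + sum c (X - {u})"
    using X(1) True by (subst sum.remove[of X u]) (auto intro!: sum.cong)
  moreover have "sum c X = c u + sum c (X - {u})"
    using X(1) True by (rule sum.remove)
  moreover have "card (nbs N X - B) - 1 \<le> card (nbs N X - insert v B)"
    unfolding card_nbs_insert[OF X(1)] by simp
  ultimately have False using X(2) u hallD[OF X(1)] by linarith
  then show ?thesis ..
next
  case False
  then have "sum (c(u := c u - 1)) X = sum c X" by (intro sum.cong) auto
  then have "\<not> sum c X \<le> card (nbs N X - insert v B)" using X(2) by simp
  from violator_root[OF X(1) this] show ?thesis using False by blast
qed

text \<open>Rado's argument: if every neighbour of \<open>u\<close> were blocked by a tight set, the
  union of these sets would be tight too, leaving nothing for \<open>u\<close>.\<close>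

lemma hall_child:
  assumes u: "c u > 0"
  shows "\<exists>v\<in>N u - B. hall N (c(u := c u - 1)) (insert v B)"
proof (rule ccontr)
  assume "\<not> ?thesis"
  then have "\<forall>v\<in>N u - B. \<exists>X. finite X \<and> \<not> sum (c(u := c u - 1)) X \<le> card (nbs N X - insert v B)"
    by (auto simp: hall_def)
  then have "\<forall>v\<in>N u - B. \<exists>X. u \<notin> X \<and> tight N c B X \<and> v \<in> nbs N X"
    using violator_edge[OF u] by meson
  then obtain T where T: "\<And>v. v \<in> N u - B \<Longrightarrow> u \<notin> T v \<and> tight N c B (T v) \<and> v \<in> nbs N (T v)"
    by metis
  have "finite S \<Longrightarrow> S \<subseteq> N u - B \<Longrightarrow> tight N c B (\<Union>v\<in>S. T v)" for S
  proof (induction S rule: finite_induct)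
    case empty
    then show ?case by (simp add: tight_def)
  next
    case (insert v S)
    then show ?case using T[of v] by (simp add: tight_Un_Int(1))
  qed
  then have t: "tight N c B (\<Union>v\<in>N u - B. T v)" (is "tight N c B ?T") using fin[of u]
    by simp
  have "N u - B \<subseteq> nbs N ?T" using T by (force simp: nbs_def)
  then have "nbs N (insert u ?T) - B = nbs N ?T - B" by auto
  moreover have "u \<notin> ?T" "finite ?T" using T t by (auto simp: tight_def)
  ultimately have "c u + sum c ?T \<le> sum c ?T" using hallD[of "insert u ?T"] t
    by (simp add: tight_def)
  then show False using u by simp
qed

text \<open>If \<open>v\<close> cannot be left out, take a minimal tight set seeing \<open>v\<close>; any of its elements
  adjacent to \<open>v\<close> can be given \<open>v\<close>, because tight sets seeing \<open>v\<close> are closed under intersection.\<close>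

lemma hall_parent:
  assumes v: "v \<notin> B"
  shows "hall N c (insert v B) \<or> (\<exists>u. v \<in> N u \<and> c u > 0 \<and> hall N (c(u := c u - 1)) (insert v B))"
proof (cases "hall N c (insert v B)")
  case False
  define S where "S X \<longleftrightarrow> tight N c B X \<and> v \<in> nbs N X" for X
  from False obtain X0 where "S X0" using violator_root unfolding hall_def S_def by metis
  then obtain X where X: "S X" and min: "\<And>Y. S Y \<Longrightarrow> card X \<le> card Y"
    using ex_has_least_nat[of S X0 card] by blast
  have fX: "finite X" and tX: "tight N c B X" using X by (auto simp: S_def tight_def)
  obtain u where u: "u \<in> X" "v \<in> N u" using X by (auto simp: S_def nbs_def)
  have small: "\<not> S Y" if "Y \<subseteq> X" "u \<notin> Y" for Y
  proof
    assume "S Y"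
    moreover have "card Y < card X" using that u(1) by (intro psubset_card_mono[OF fX]) blast
    ultimately show False using min[of Y] by simp
  qed
  \<comment> \<open>Without demand at \<open>u\<close>, the set \<open>X - {u}\<close> has the same
    demand and, by Hall's condition, no fewer free neighbours. It would be tight and see
    \<open>v\<close>, against minimality.\<close>
  have cu: "c u > 0"
  proof (rule ccontr)
    assume "\<not> c u > 0"
    then have s: "sum c (X - {u}) = sum c X" using sum.remove[OF fX u(1), of c] by simp
    have sub: "nbs N (X - {u}) - B \<subseteq> nbs N X - B" by (auto simp: nbs_def)
    have f: "finite (nbs N X - B)" using finite_nbs fX by simp
    have "sum c (X - {u}) \<le> card (nbs N (X - {u}) - B)" using hallD fX by simp
    moreover have "card (nbs N (X - {u}) - B) \<le> card (nbs N X - B)" using sub f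
      by (rule card_mono[rotated])
    ultimately have eq: "card (nbs N (X - {u}) - B) = card (nbs N X - B)" "sum c (X - {u}) = card (nbs N (X - {u}) - B)"
      using s tX by (auto simp: tight_def)
    have "nbs N (X - {u}) - B = nbs N X - B" using sub f eq(1) by (intro card_subset_eq) auto
    then have "S (X - {u})" using X v eq(2) fX by (auto simp: S_def tight_def)
    then show False using small[of "X - {u}"] by auto
  qed
  have "hall N (c(u := c u - 1)) (insert v B)"
  proof (rule ccontr)
    assume "\<not> ?thesis"
    then obtain Z where Z: "u \<notin> Z" "tight N c B Z" "v \<in> nbs N Z"
      using violator_edge[OF cu] unfolding hall_def by metis
    have "v \<in> nbs N (Z \<inter> X)" using tight_Un_Int(3)[OF Z(2) tX] Z(3) X v
      by (auto simp: S_def)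
    then have "S (Z \<inter> X)" using tight_Un_Int(2)[OF Z(2) tX] by (simp add: S_def)
    then show False using small[of "Z \<inter> X"] Z(1) by auto
  qed
  then show ?thesis using u cu by blast
qed simp

end

text \<open>\<open>nb\<close> replaces distance: \<open>(nb ^^ i) m\<close> bounds all vertices
  reachable from \<open>{..m}\<close> along at most \<open>i\<close> edges. By symmetry of
  \<open>E\<close> the same function serves both directions of an edge.\<close>

locale harem =
  fixes E :: "(nat \<times> nat) set" and d :: nat and h nb :: "nat \<Rightarrow> nat"
  assumes sym: "(u, v) \<in> E \<Longrightarrow> (v, u) \<in> E"
    and pos: "(u, v) \<in> E \<Longrightarrow> u \<noteq> 0"
    and fin: "finite {v. (u, v) \<in> E}"
    and h0: "h 0 = 0"
    and expand: "finite X \<Longrightarrow> 0 \<notin> X \<Longrightarrow> h n \<le> card X \<Longrightarrow> n + d * card X \<le> card (nbs (\<lambda>u. {v. (u, v) \<in> E}) X)"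
    and nb_ge: "w \<le> nb w"
    and nb_bound: "x \<le> w \<Longrightarrow> (x, v) \<in> E \<Longrightarrow> v \<le> nb w"
begin

abbreviation N :: "nat \<Rightarrow> nat set" where "N u \<equiv> {v. (u, v) \<in> E}"

lemma expand0: "finite X \<Longrightarrow> 0 \<notin> X \<Longrightarrow> d * card X \<le> card (nbs N X)"
  using expand[of X 0] h0 by simp

lemma funpow_nb_mono: "i \<le> j \<Longrightarrow> (nb ^^ i) m \<le> (nb ^^ j) m"
  by (induction j) (auto simp: le_Suc_eq intro: order_trans[OF _ nb_ge])

text \<open>The part of a violator far away from \<open>B\<close> and from its near part only helps, so it can be
  discarded; \<open>h\<close> bounds the size of a violator, hence the distance at which a gap must occur.\<close>

lemma hall_bounded:
  assumes B: "B \<subseteq> {..m}" "card B \<le> b"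
    and c: "\<And>x. c x \<le> d" "c 0 = 0"
    and horizon: "\<And>X. X \<subseteq> {..(nb ^^ (2 * h b + 1)) m} \<Longrightarrow> sum c X \<le> card (nbs N X - B)"
  shows "hall N c B"
  unfolding hall_def
proof (intro allI impI, rule ccontr)
  fix X0 :: "nat set" assume X0: "finite X0" "\<not> sum c X0 \<le> card (nbs N X0 - B)"
  define X where "X = X0 - {0}"
  have X: "finite X" "0 \<notin> X" using X0 by (auto simp: X_def)
  have "sum c X0 = sum c X" unfolding X_def using X0 c by (intro sum.mono_neutral_right) auto
  moreover have "nbs N X0 = nbs N X" unfolding X_def nbs_def using pos by blast
  ultimately have viol: "\<not> sum c X \<le> card (nbs N X - B)" using X0 by simp
  have sum_le: "sum c Y \<le> d * card Y" for Y
    using sum_bounded_above[of Y c d] c(1) by (simp add: mult.commute)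
  have finN: "finite (nbs N Y)" if "finite Y" for Y using that fin by (simp add: nbs_def)
  have finB: "finite B" using B(1) finite_subset by blast
  \<comment> \<open>Expansion with \<open>n = b\<close> gives \<open>b\<close> surplus neighbours,
    enough to replace the at most \<open>b\<close> vertices lost to \<open>B\<close>.\<close>
  have small: "card X < h b"
  proof (rule ccontr)
    assume "\<not> card X < h b"
    then have "b + d * card X \<le> card (nbs N X)" using expand X by simp
    moreover have "card (nbs N X) - card B \<le> card (nbs N X - B)" using finB
      by (rule diff_card_le_card_Diff)
    ultimately show False using viol sum_le[of X] B(2) by linarith
  qed
  \<comment> \<open>Each layer advances by two applications of \<open>nb\<close>, because vertices
    with a common neighbour are two edges apart. The extra application at the start keeps the far
    part away from the neighbours of \<open>B\<close>.\<close>
  define T where "T i = (nb ^^ (2 * i + 1)) m" for i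
  define L where "L i = X \<inter> {..T i}" for i
  have T_Suc: "T (Suc i) = nb (nb (T i))" for i by (simp add: T_def)
  have L_mono: "L i \<subseteq> L (Suc i)" for i
    using funpow_nb_mono[of "2 * i + 1" "2 * Suc i + 1" m] by (auto simp: L_def T_def)
  \<comment> \<open>Layers that grew strictly \<open>card X + 1\<close> times would outgrow
    \<open>X\<close>.\<close>
  have "\<exists>i\<le>card X. L i = L (Suc i)"
  proof (rule ccontr)
    assume no: "\<not> ?thesis"
    have "i \<le> card X + 1 \<Longrightarrow> i \<le> card (L i)" for i
    proof (induction i)
      case (Suc i)
      then have "L i \<subset> L (Suc i)" using no L_mono[of i] by auto
      then have "card (L i) < card (L (Suc i))" using X
        by (intro psubset_card_mono) (auto simp: L_def)
      then show ?case using Suc by simp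
    qed simp
    from this[of "card X + 1"] have "card X + 1 \<le> card (L (card X + 1))" by simp
    also have "\<dots> \<le> card X" using X by (intro card_mono) (auto simp: L_def)
    finally show False by simp
  qed
  then obtain i where i: "i \<le> card X" "L i = L (Suc i)" by blast
  define Y where "Y = X - L i"
  have XY: "X = L i \<union> Y" "L i \<inter> Y = {}" "finite Y" "finite (L i)" using X
    by (auto simp: Y_def L_def)
  have far: "y > nb (nb (T i))" if "y \<in> Y" for y
  proof -
    have "y \<notin> L (Suc i)" using that i by (auto simp: Y_def)
    then show ?thesis using that T_Suc by (auto simp: L_def Y_def)
  qed
  have YB: "nbs N Y \<inter> B = {}"
  proof (rule ccontr)
    assume "nbs N Y \<inter> B \<noteq> {}"
    then obtain y v where "y \<in> Y" "(y, v) \<in> E" "v \<in> B" by (auto simp: nbs_def)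
    moreover have "nb m \<le> T i" using funpow_nb_mono[of 1 "2 * i + 1" m] by (simp add: T_def)
    ultimately show False
      using nb_bound[of v m y] sym[of y v] far[of y] B(1) nb_ge[of "T i"] nb_ge[of "nb (T i)"]
        by force
  qed
  have YX: "nbs N Y \<inter> nbs N (L i) = {}"
  proof (rule ccontr)
    assume "nbs N Y \<inter> nbs N (L i) \<noteq> {}"
    then obtain y x v where v: "y \<in> Y" "(y, v) \<in> E" "x \<in> L i" "(x, v) \<in> E"
      by (auto simp: nbs_def)
    then have "v \<le> nb (T i)" using nb_bound[of x "T i" v] by (auto simp: L_def)
    then have "y \<le> nb (nb (T i))" using nb_bound sym v by blast
    then show False using far v by force
  qed
  have "L i \<subseteq> {..(nb ^^ (2 * h b + 1)) m}"
  proof -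
    have "T i \<le> (nb ^^ (2 * h b + 1)) m"
      unfolding T_def using i small by (intro funpow_nb_mono) simp
    then show ?thesis unfolding L_def by auto
  qed
  then have "sum c (L i) \<le> card (nbs N (L i) - B)" by (rule horizon)
  \<comment> \<open>The neighbours of the far part avoid \<open>B\<close>, so the inequality coming
    from \<open>h 0 = 0\<close> already covers its demand.\<close>
  moreover have "sum c Y \<le> card (nbs N Y)"
    using sum_le[of Y] expand0[OF XY(3)] X by (auto simp: Y_def)
  moreover have "sum c X = sum c (L i) + sum c Y" using XY by (metis sum.union_disjoint)
  moreover have "card (nbs N X - B) = card (nbs N (L i) - B) + card (nbs N Y)"
  proof -
    have "nbs N X - B = (nbs N (L i) - B) \<union> nbs N Y" using XY(1) YB nbs_Un[of N "L i" Y]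
      by auto
    moreover have "(nbs N (L i) - B) \<inter> nbs N Y = {}" using YX by auto
    ultimately show ?thesis using XY finN by (simp add: card_Un_disjoint)
  qed
  ultimately show False using viol by linarith
qed

section \<open>Finite pieces of the parent matching\<close>

definition demand :: "(nat \<Rightarrow> nat) \<Rightarrow> nat \<Rightarrow> nat" where
  "demand f u = (if u = 0 then 0 else d - card {v. f v = Suc u})"

text \<open>A state \<open>f\<close> is a finite piece of a matching: \<open>f v\<close> is \<open>0\<close> if \<open>v\<close> is undecided,
  \<open>1\<close> if \<open>v\<close> stays unmatched, and \<open>Suc u\<close> if \<open>v\<close> is matched with \<open>u \<noteq> 0\<close>.\<close>

definition partial :: "(nat \<Rightarrow> nat) \<Rightarrow> bool" where
  "partial f \<longleftrightarrow> finite {v. f v \<noteq> 0} \<and> f 0 = 0 \<and>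
    (\<forall>v. f v > 1 \<longrightarrow> (f v - 1, v) \<in> E \<and> card {w. f w = f v} \<le> d) \<and>
    hall N (demand f) {v. f v \<noteq> 0}"

lemma partial_edge:
  assumes f: "partial f" and v: "f v = 0" "(u, v) \<in> E" and u: "demand f u > 0"
    and hall: "hall N ((demand f)(u := demand f u - 1)) (insert v {v. f v \<noteq> 0})"
  shows "partial (f(v := Suc u))" "demand (f(v := Suc u)) = (demand f)(u := demand f u - 1)"
proof -
  have "demand f 0 = 0" by (simp add: demand_def)
  then have u0: "u \<noteq> 0" using u by (metis less_irrefl)
  have v0: "v \<noteq> 0" using sym[OF v(2)] pos by blast
  have fin: "finite {v. f v \<noteq> 0}" using f by (simp add: partial_def)
  have "{w. (f(v := Suc u)) w = Suc u} = insert v {w. f w = Suc u}" by auto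
  moreover have "finite {w. f w = Suc u}" by (rule finite_subset[OF _ fin]) auto
  ultimately have card: "card {w. (f(v := Suc u)) w = Suc u} = Suc (card {w. f w = Suc u})"
    using v by simp
  have other: "{w. (f(v := Suc u)) w = x} = {w. f w = x}" if "x \<noteq> Suc u" "x \<noteq> 0" for x
    using that v by auto
  show dem: "demand (f(v := Suc u)) = (demand f)(u := demand f u - 1)"
  proof
    fix x show "demand (f(v := Suc u)) x = ((demand f)(u := demand f u - 1)) x"
      using card u0 other[of "Suc x"] unfolding demand_def by (cases "x = u") auto
  qed
  have B: "{w. (f(v := Suc u)) w \<noteq> 0} = insert v {w. f w \<noteq> 0}" by auto
  have "((f(v := Suc u)) w - 1, w) \<in> E \<and> card {x. (f(v := Suc u)) x = (f(v := Suc u)) w} \<le> d"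
    if "(f(v := Suc u)) w > 1" for w
  proof (cases "(f(v := Suc u)) w = Suc u")
    case True
    have "card {w. f w = Suc u} < d" using u u0 by (simp add: demand_def)
    moreover have "(u, w) \<in> E" using True v(2) f that u0 unfolding partial_def
      by (metis diff_Suc_1 fun_upd_apply that)
    ultimately show ?thesis unfolding True using card by simp
  next
    case False
    then have "w \<noteq> v" by auto
    then show ?thesis using False that f other[of "f w"] by (auto simp: partial_def)
  qed
  then show "partial (f(v := Suc u))"
    using f fin hall v0 unfolding partial_def B dem by simp
qed

text \<open>Later stages cannot reopen a demand that has been met.\<close>

lemma demand_extends:
  assumes "partial g" "extends f g"
  shows "demand g u \<le> demand f u"
proof -
  have "{v. f v = Suc u} \<subseteq> {v. g v = Suc u}" using assms(2) by (auto simp: extends_def)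
  moreover have "finite {v. g v = Suc u}"
    by (rule finite_subset[of _ "{v. g v \<noteq> 0}"]) (use assms in \<open>auto simp: partial_def\<close>)
  ultimately have "card {v. f v = Suc u} \<le> card {v. g v = Suc u}" by (rule card_mono[rotated])
  then show ?thesis by (simp add: demand_def diff_le_mono2)
qed

lemma partial_saturate:
  "partial f \<Longrightarrow> \<exists>g. extends f g \<and> partial g \<and> demand g u = 0"
proof (induction "demand f u" arbitrary: f)
  case 0
  then show ?case by (intro exI[of _ f]) simp
next
  case (Suc k)
  have "hall N (demand f) {v. f v \<noteq> 0}" using Suc.prems by (simp add: partial_def)
  from hall_child[OF fin this, of u] Suc.hyps(2) obtain v where
    v: "(u, v) \<in> E" "f v = 0" "hall N ((demand f)(u := demand f u - 1)) (insert v {v. f v \<noteq> 0})"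
      by auto
  let ?f = "f(v := Suc u)"
  have f: "partial ?f" "demand ?f = (demand f)(u := demand f u - 1)"
    using partial_edge[OF Suc.prems v(2,1) _ v(3)] Suc.hyps(2) by auto
  have "k = demand ?f u" unfolding f(2) using Suc.hyps(2) by simp
  from Suc.hyps(1)[OF this f(1)] obtain g where "extends ?f g" "partial g" "demand g u = 0" by blast
  moreover have "extends f ?f" using v by (auto simp: extends_def)
  ultimately show ?case using extends_trans by blast
qed

lemma partial_decide:
  assumes f: "partial f" and v: "v \<noteq> 0"
  shows "\<exists>g. extends f g \<and> partial g \<and> g v \<noteq> 0"
proof (cases "f v = 0")
  case True
  have H: "hall N (demand f) {v. f v \<noteq> 0}" using f by (simp add: partial_def)
  have e: "extends f (f(v := k))" for k using True by (auto simp: extends_def)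
  from hall_parent[OF fin H, of v] True
  consider "hall N (demand f) (insert v {v. f v \<noteq> 0})"
    | u where "(u, v) \<in> E" "demand f u > 0" "hall N ((demand f)(u := demand f u - 1)) (insert v {v. f v \<noteq> 0})"
    by auto
  then show ?thesis
  proof cases
    case 1
    \<comment> \<open>The value \<open>1\<close> stands for no parent, so leaving \<open>v\<close>
      unmatched changes no demand.\<close>
    have other: "{w. (f(v := 1)) w = x} = {w. f w = x}" if "x > 1" for x
      using that True by auto
    then have dem: "demand (f(v := 1)) = demand f" by (auto simp: demand_def)
    have B: "{w. (f(v := 1)) w \<noteq> 0} = insert v {w. f w \<noteq> 0}" by auto
    have "((f(v := 1)) w - 1, w) \<in> E \<and> card {x. (f(v := 1)) x = (f(v := 1)) w} \<le> d"
      if "(f(v := 1)) w > 1" for w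
    proof -
      have w: "(f(v := 1)) w = f w" "f w > 1" using that by (auto split: if_splits)
      show ?thesis unfolding w(1) other[OF w(2)] using f w(2) by (simp add: partial_def)
    qed
    then have "partial (f(v := 1))" using f 1 v unfolding partial_def B dem by simp
    then show ?thesis using e by (intro exI[of _ "f(v := 1)"]) simp
  next
    case 2
    then show ?thesis using partial_edge(1)[OF f True 2] e by (intro exI[of _ "f(v := Suc u)"]) simp
  qed
qed (use f in \<open>auto intro: exI[of _ f]\<close>)

text \<open>This is the radius from \<open>hall_bounded\<close> with \<open>m = b = t\<close>: the
  support of \<open>lookup t\<close> lies below \<open>t\<close> and hence has at most
  \<open>t\<close> elements.\<close>

definition horizon :: "nat \<Rightarrow> nat" where "horizon t = (nb ^^ (2 * h t + 1)) t"

text \<open>All quantifiers on the right are bounded, which is what decidability needs. The number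
  \<open>s\<close> runs through codes of all subsets of \<open>{..horizon t}\<close>.\<close>

lemma partial_lookup:
  "partial (lookup t) \<longleftrightarrow> lookup t 0 = 0 \<and>
    (\<forall>v<t. lookup t v > 1 \<longrightarrow> (lookup t v - 1, v) \<in> E \<and> card {w. w < t \<and> lookup t w = lookup t v} \<le> d) \<and>
    (\<forall>s<2 ^ Suc (horizon t). (\<Sum>x<Suc (horizon t). if x \<in> set_decode s then demand (lookup t) x else 0)
      \<le> card {v. v < Suc (nb (horizon t)) \<and> lookup t v = 0 \<and> (\<exists>x<Suc (horizon t). x \<in> set_decode s \<and> (x, v) \<in> E)})"
proof -
  have fin: "finite {v. lookup t v \<noteq> 0}"
    by (rule finite_subset[of _ "{..<t}"]) (use lookup_less in blast)+
  have fiber: "{w. w < t \<and> lookup t w = lookup t v} = {w. lookup t w = lookup t v}" if "lookup t v > 1" for v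
    using that lookup_less[of t] by fastforce
  have edges: "(\<forall>v. lookup t v > 1 \<longrightarrow> (lookup t v - 1, v) \<in> E \<and> card {w. lookup t w = lookup t v} \<le> d) \<longleftrightarrow>
    (\<forall>v<t. lookup t v > 1 \<longrightarrow> (lookup t v - 1, v) \<in> E \<and> card {w. w < t \<and> lookup t w = lookup t v} \<le> d)"
  proof -
    have "v < t" if "lookup t v > 1" for v using lookup_less[of t v] that by simp
    then show ?thesis using fiber by metis
  qed
  define P where "P X \<longleftrightarrow> sum (demand (lookup t)) X \<le> card (nbs N X - {v. lookup t v \<noteq> 0})" for X
  have *: "hall N (demand (lookup t)) {v. lookup t v \<noteq> 0} \<longleftrightarrow> (\<forall>X. X \<subseteq> {..horizon t} \<longrightarrow> P X)"
  proof
    assume "hall N (demand (lookup t)) {v. lookup t v \<noteq> 0}"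
    then show "\<forall>X. X \<subseteq> {..horizon t} \<longrightarrow> P X"
      unfolding hall_def P_def using finite_subset by blast
  next
    assume A: "\<forall>X. X \<subseteq> {..horizon t} \<longrightarrow> P X"
    show "hall N (demand (lookup t)) {v. lookup t v \<noteq> 0}"
    proof (rule hall_bounded[where m = t and b = t])
      have sub: "{v. lookup t v \<noteq> 0} \<subseteq> {..<t}" using lookup_less by blast
      then show "{v. lookup t v \<noteq> 0} \<subseteq> {..t}" by auto
      show "card {v. lookup t v \<noteq> 0} \<le> t" using card_mono[OF _ sub] by simp
    qed (use A in \<open>auto simp: demand_def P_def horizon_def\<close>)
  qed
  have **: "(\<forall>X. X \<subseteq> {..horizon t} \<longrightarrow> P X) \<longleftrightarrow> (\<forall>s<2 ^ Suc (horizon t). P (set_decode s \<inter> {..horizon t}))"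
  proof (intro iffI allI impI)
    fix X assume A: "\<forall>s<2 ^ Suc (horizon t). P (set_decode s \<inter> {..horizon t})" and X: "X \<subseteq> {..horizon t}"
    then have "finite X" using finite_subset by blast
    moreover have "set_encode X < 2 ^ Suc (horizon t)"
    proof -
      have "set_encode X \<le> (\<Sum>i\<in>{0..<Suc (horizon t)}. 2 ^ i)"
        unfolding set_encode_def using X by (intro sum_mono2) auto
      also have "\<dots> < 2 ^ Suc (horizon t)" unfolding sum_power2 by simp
      finally show ?thesis .
    qed
    ultimately show "P X" using A X by (metis inf.absorb1 set_encode_inverse)
  qed auto
  have ***: "P (set_decode s \<inter> {..horizon t}) \<longleftrightarrow> (\<Sum>x<Suc (horizon t). if x \<in> set_decode s then demand (lookup t) x else 0)
      \<le> card {v. v < Suc (nb (horizon t)) \<and> lookup t v = 0 \<and> (\<exists>x<Suc (horizon t). x \<in> set_decode s \<and> (x, v) \<in> E)}" for s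
  proof -
    have "sum (demand (lookup t)) (set_decode s \<inter> {..horizon t}) = (\<Sum>x<Suc (horizon t). if x \<in> set_decode s then demand (lookup t) x else 0)"
      by (simp add: sum.If_cases lessThan_Suc_atMost Int_commute)
    moreover have "nbs N (set_decode s \<inter> {..horizon t}) - {v. lookup t v \<noteq> 0} =
      {v. v < Suc (nb (horizon t)) \<and> lookup t v = 0 \<and> (\<exists>x<Suc (horizon t). x \<in> set_decode s \<and> (x, v) \<in> E)}"
      using nb_bound[of _ "horizon t"] by (auto simp: nbs_def less_Suc_eq_le)
    ultimately show ?thesis by (simp only: P_def)
  qed
  show ?thesis unfolding partial_def edges * ** *** by (simp only: fin simp_thms)
qed

lemma demand_lookup: "demand (lookup t) u = (if u = 0 then 0 else d - card {v. v < t \<and> lookup t v = Suc u})"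
proof -
  have "{v. v < t \<and> lookup t v = Suc u} = {v. lookup t v = Suc u}" using lookup_less[of t]
    by fastforce
  then show ?thesis by (simp add: demand_def)
qed

definition matched :: "nat \<Rightarrow> (nat \<Rightarrow> nat) \<Rightarrow> bool" where
  "matched n f \<longleftrightarrow> partial f \<and> (\<forall>v<Suc n. v \<noteq> 0 \<longrightarrow> f v \<noteq> 0 \<and> demand f v = 0)"

lemma decidable_matched:
  assumes h: "computable h" and nb: "computable nb" and E: "\<And>a b. computable a \<Longrightarrow> computable b \<Longrightarrow> decidable (\<lambda>e. (a e, b e) \<in> E)"
  shows "decidable (\<lambda>e. matched (pfst e) (lookup (psnd e)))"
proof -
  note computable_E_intros = computable_intros computable_comp[OF h] computable_comp[OF nb] E
  have demand: "computable (\<lambda>e. demand (lookup (a e)) (b e))" if "computable a" "computable b" for a b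
    unfolding demand_lookup by (assumption | rule that computable_E_intros computable_comp[OF that(1)] computable_comp[OF that(2)])+
  have horizon: "computable horizon" unfolding horizon_def by (rule computable_E_intros)+
  have partial: "decidable (\<lambda>e. partial (lookup (psnd e)))"
    unfolding partial_lookup by (rule computable_E_intros demand computable_comp[OF horizon])+
  show ?thesis unfolding matched_def by (rule computable_E_intros partial demand)+
qed

theorem computable_parents:
  assumes h: "computable h" and nb: "computable nb" and E: "\<And>a b. computable a \<Longrightarrow> computable b \<Longrightarrow> decidable (\<lambda>e. (a e, b e) \<in> E)"
    and d: "d > 0"
  shows "\<exists>p. computable p \<and> p 0 = 0 \<and> (\<forall>v. p v \<noteq> 0 \<longrightarrow> (p v, v) \<in> E) \<and> (\<forall>u. u \<noteq> 0 \<longrightarrow> card {v. p v = u} = d)"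
proof -
  have "\<exists>\<phi> F. computable \<phi> \<and> (\<forall>n. finite {v. F n v \<noteq> 0} \<and> matched n (F n) \<and> extends (F n) \<phi> \<and> extends (F n) (F (Suc n)))"
  proof (rule computable_limit[OF decidable_matched[OF h nb E]])
    show "finite {v. (\<lambda>_. 0::nat) v \<noteq> 0}" by simp
    have "sum (demand (\<lambda>_. 0)) X \<le> card (nbs N X)" if X: "finite X" for X
    proof -
      have "sum (demand (\<lambda>_. 0)) X = sum (\<lambda>_. d) (X - {0})"
        using X by (intro sum.mono_neutral_cong_right) (auto simp: demand_def)
      also have "\<dots> \<le> card (nbs N (X - {0}))" using expand0[of "X - {0}"] X
        by (simp add: mult.commute)
      also have "\<dots> \<le> card (nbs N X)"
        using X fin by (intro card_mono nbs_mono) (auto simp: nbs_def)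
      finally show ?thesis .
    qed
    then show "matched 0 (\<lambda>_. 0)" by (simp add: matched_def partial_def hall_def)
    show "\<exists>g. finite {v. g v \<noteq> 0} \<and> extends f g \<and> matched (Suc n) g" if f: "matched n f" for n f
    proof -
      obtain g1 where g1: "extends f g1" "partial g1" "demand g1 (Suc n) = 0"
        using partial_saturate f unfolding matched_def by blast
      obtain g where g: "extends g1 g" "partial g" "g (Suc n) \<noteq> 0"
        using partial_decide[OF g1(2)] by blast
      have e: "extends f g" using extends_trans g1 g by blast
      have "g v \<noteq> 0 \<and> demand g v = 0" if v: "v < Suc (Suc n)" "v \<noteq> 0" for v
      proof (cases "v = Suc n")
        case True
        then show ?thesis using g g1 demand_extends[OF g(2,1), of v] by simp
      next
        case False
        then have "f v \<noteq> 0" "demand f v = 0" using f v by (auto simp: matched_def)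
        then show ?thesis using e demand_extends[OF g(2) e, of v] by (auto simp: extends_def)
      qed
      then show ?thesis using g e by (intro exI[of _ g]) (auto simp: matched_def partial_def)
    qed
  qed (auto simp: matched_def partial_def)
  then obtain \<phi> F where \<phi>: "computable \<phi>" and F: "\<And>n. matched n (F n)" "\<And>n. extends (F n) \<phi>" "\<And>n. extends (F n) (F (Suc n))"
    by blast
  have P: "partial (F n)" for n using F(1) by (simp add: matched_def)
  have nz: "F n v \<noteq> 0" "demand (F n) v = 0" if "v \<noteq> 0" "v \<le> n" for n v
    using F(1)[of n] that by (auto simp: matched_def)
  have eq: "\<phi> v = F n v" if "F n v \<noteq> 0" for n v using F(2)[of n] that
    by (simp add: extends_def)
  define p where "p v = (if v = 0 then 0 else \<phi> v - 1)" for v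
  have "computable p" unfolding p_def by (rule computable_intros computable_comp[OF \<phi>])+
  moreover have "p 0 = 0" by (simp add: p_def)
  moreover have "(p v, v) \<in> E" if "p v \<noteq> 0" for v
  proof -
    have v: "v \<noteq> 0" "\<phi> v > 1" using that by (auto simp: p_def split: if_splits)
    then have "\<phi> v = F v v" using eq nz by blast
    then show ?thesis using P[of v] v by (simp add: p_def partial_def)
  qed
  \<comment> \<open>At stage \<open>u\<close> the vertex \<open>u\<close> has its \<open>d\<close>
    children, and no later stage allows more than \<open>d\<close>, so its fibre is final.\<close>
  moreover have "card {v. p v = u} = d" if u: "u \<noteq> 0" for u
  proof -
    have fib: "card {v. F n v = Suc u} = d" "finite {v. F n v = Suc u}" if "u \<le> n" for n
    proof -
      have ge: "d \<le> card {v. F n v = Suc u}" using nz(2)[OF u that] u by (simp add: demand_def)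
      then have "{v. F n v = Suc u} \<noteq> {}" using d by (metis card.empty not_le)
      then obtain v where "F n v = Suc u" by blast
      then have "card {v. F n v = Suc u} \<le> d" using P[of n] u unfolding partial_def
        by (metis One_nat_def Suc_less_eq neq0_conv)
      then show "card {v. F n v = Suc u} = d" using ge by simp
      show "finite {v. F n v = Suc u}"
        by (rule finite_subset[of _ "{v. F n v \<noteq> 0}"]) (use P[of n] in \<open>auto simp: partial_def\<close>)
    qed
    have "{v. p v = u} = {v. F u v = Suc u}"
    proof (intro set_eqI iffI)
      fix v assume "v \<in> {v. p v = u}"
      then have v: "v \<noteq> 0" "\<phi> v = Suc u" using u by (auto simp: p_def split: if_splits)
      have E: "extends (F u) (F (u + k))" for k by (induction k) (auto intro: extends_trans F(3))
      have "{w. F u w = Suc u} \<subseteq> {w. F (u + v) w = Suc u}" using E[of v]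
        by (auto simp: extends_def)
      then have "{w. F u w = Suc u} = {w. F (u + v) w = Suc u}"
        using fib[of u] fib[of "u + v"] by (intro card_subset_eq) auto
      moreover have "F (u + v) v = Suc u" using eq[of "u + v" v] nz(1)[of v "u + v"] v by simp
      ultimately show "v \<in> {v. F u v = Suc u}" by blast
    next
      fix v assume "v \<in> {v. F u v = Suc u}"
      then have v: "F u v = Suc u" by simp
      moreover have "F u 0 = 0" using P[of u] by (simp add: partial_def)
      ultimately have "v \<noteq> 0" by (metis nat.distinct(1))
      then show "v \<in> {v. p v = u}" using eq[of u v] v by (simp add: p_def)
    qed
    then show ?thesis using fib by simp
  qed
  ultimately show ?thesis by blast
qed

end

subsection \<open>Functions all of whose orbits end in 2-cycles\<close>

definition two_cyclic_after :: "nat \<Rightarrow> (nat \<Rightarrow> nat) \<Rightarrow> nat \<Rightarrow> bool" where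
  "two_cyclic_after k f v \<longleftrightarrow> (f ^^ (k + 2)) v = (f ^^ k) v"

definition all_two_cyclic_after :: "nat \<Rightarrow> (nat \<Rightarrow> nat) \<Rightarrow> bool" where
  "all_two_cyclic_after k f \<longleftrightarrow> (\<forall>v. f v \<noteq> 0 \<longrightarrow> two_cyclic_after k f v)"

lemma two_cyclic_after_Suc: "two_cyclic_after k f (f v) \<Longrightarrow> two_cyclic_after (Suc k) f v"
  by (simp add: two_cyclic_after_def funpow_swap1)

lemma two_cyclic_after_mono: "two_cyclic_after k f v \<Longrightarrow> k \<le> l \<Longrightarrow> two_cyclic_after l f v"
proof (induction l)
  case (Suc l)
  then show ?case
    by (cases "k = Suc l") (auto simp: two_cyclic_after_def)
qed simp

lemma all_two_cyclic_after_mono: "all_two_cyclic_after k f \<Longrightarrow> k \<le> l \<Longrightarrow> all_two_cyclic_after l f"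
  by (auto simp: all_two_cyclic_after_def intro: two_cyclic_after_mono)

text \<open>\<open>p v = 0\<close> means that \<open>v\<close> has no parent. Two vertices may be
  parents of each other, which is the source of the alternative \<open>p a = b\<close> in the lemmas
  on 2-cycles.\<close>

locale parents =
  fixes p :: "nat \<Rightarrow> nat" and d :: nat
  assumes d: "2 \<le> d"
    and p0 [simp]: "p 0 = 0"
    and noloop: "v \<noteq> 0 \<Longrightarrow> p v \<noteq> v"
    and kids: "u \<noteq> 0 \<Longrightarrow> card {v. p v = u} = d"
begin

text \<open>\<open>range f - {0}\<close> is the set of vertices whose preimages are already fixed; \<open>0\<close> means
  undefined.\<close>

definition piece :: "(nat \<Rightarrow> nat) \<Rightarrow> bool" where
  "piece f \<longleftrightarrow> finite {v. f v \<noteq> 0} \<and> f 0 = 0 \<and>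
     (\<forall>v. f v \<noteq> 0 \<longrightarrow> f (f v) \<noteq> 0 \<and> (f v = p v \<or> p (f v) = v) \<and> card {w. f w = f v} = d - 1) \<and>
     (\<forall>m m'. f m \<noteq> 0 \<longrightarrow> f m' \<noteq> 0 \<longrightarrow> p m = p m' \<longrightarrow> p m \<noteq> 0 \<longrightarrow> p m \<notin> range f \<longrightarrow> m = m')"

definition marked :: "(nat \<Rightarrow> nat) \<Rightarrow> nat \<Rightarrow> bool" where
  "marked f y \<longleftrightarrow> y \<noteq> 0 \<and> y \<notin> range f \<and> (\<exists>m. f m \<noteq> 0 \<and> p m = y)"

text \<open>The vertex \<open>q\<close> is the one place where a repair is pending. Since
  \<open>0\<close> is never marked, \<open>q = 0\<close> means that there is no exception; the same
  holds for \<open>unassigned\<close>.\<close>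

definition separated :: "nat \<Rightarrow> (nat \<Rightarrow> nat) \<Rightarrow> bool" where
  "separated q f \<longleftrightarrow> (\<forall>y. marked f y \<longrightarrow> marked f (p y) \<longrightarrow> y = q \<or> p y = q)"

definition unassigned :: "nat \<Rightarrow> (nat \<Rightarrow> nat) \<Rightarrow> bool" where
  "unassigned q f \<longleftrightarrow> (\<forall>y. marked f y \<longrightarrow> f y = 0 \<or> y = q)"

definition good :: "(nat \<Rightarrow> nat) \<Rightarrow> bool" where
  "good f \<longleftrightarrow> piece f \<and> separated 0 f \<and> unassigned 0 f"

lemma separatedD: "separated q f \<Longrightarrow> marked f y \<Longrightarrow> marked f (p y) \<Longrightarrow> y = q \<or> p y = q"
  and unassignedD: "unassigned q f \<Longrightarrow> marked f y \<Longrightarrow> y \<noteq> q \<Longrightarrow> f y = 0"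
  unfolding separated_def unassigned_def by metis+

section \<open>Pieces, their extensions and free children\<close>

lemma finite_kids: "u \<noteq> 0 \<Longrightarrow> finite {v. p v = u}"
  using kids[of u] d by (intro card_ge_0_finite) simp

lemma piece_fin: "piece f \<Longrightarrow> finite {v. f v \<noteq> 0}"
  and core_0: "piece f \<Longrightarrow> f 0 = 0"
  and piece_step: "piece f \<Longrightarrow> f v \<noteq> 0 \<Longrightarrow> f (f v) \<noteq> 0"
  and piece_edge: "piece f \<Longrightarrow> f v \<noteq> 0 \<Longrightarrow> f v = p v \<or> p (f v) = v"
  and piece_card: "piece f \<Longrightarrow> f v \<noteq> 0 \<Longrightarrow> card {w. f w = f v} = d - 1"
  and piece_one: "piece f \<Longrightarrow> f m \<noteq> 0 \<Longrightarrow> f m' \<noteq> 0 \<Longrightarrow> p m = p m' \<Longrightarrow> p m \<noteq> 0 \<Longrightarrow> p m \<notin> range f \<Longrightarrow> m = m'"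
  by (simp_all add: piece_def)

lemma piece_range: "piece f \<Longrightarrow> f x = 0 \<Longrightarrow> x \<noteq> 0 \<Longrightarrow> x \<notin> range f"
  by (metis piece_step rangeE)

lemma range_extends: "piece f \<Longrightarrow> extends f g \<Longrightarrow> g 0 = 0 \<Longrightarrow> x \<in> range f \<Longrightarrow> x \<in> range g"
  unfolding extends_def by (metis rangeE rangeI)

lemma finite_marked: "piece f \<Longrightarrow> finite {y. marked f y}"
  by (rule finite_subset[of _ "p ` {v. f v \<noteq> 0}"], auto simp: marked_def) (use piece_fin in auto)

lemma funpow_extends:
  assumes "piece f" "extends f g" "f v \<noteq> 0"
  shows "(g ^^ n) v = (f ^^ n) v \<and> f ((f ^^ n) v) \<noteq> 0"
proof (induction n)
  case (Suc n)
  then show ?case using assms by (simp add: extends_def piece_step)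
qed (use assms in simp)

lemma two_cyclic_after_extends: "piece f \<Longrightarrow> extends f g \<Longrightarrow> f v \<noteq> 0 \<Longrightarrow> two_cyclic_after k f v \<Longrightarrow> two_cyclic_after k g v"
  unfolding two_cyclic_after_def using funpow_extends[of f g v "k + 2"] funpow_extends[of f g v k]
    by metis

text \<open>The last clause of \<open>piece\<close> allows one assigned child at most. Even then
  \<open>d - 1\<close> children are left, just as many as a fibre requires.\<close>

lemma card_free_kids:
  assumes "piece f" "y \<noteq> 0" "y \<notin> range f"
  shows "card {v. p v = y \<and> f v = 0} = (if marked f y then d - 1 else d)"
proof (cases "marked f y")
  case True
  then obtain m where m: "f m \<noteq> 0" "p m = y" by (auto simp: marked_def)
  have "v = m" if "p v = y" "f v \<noteq> 0" for v
    using piece_one[OF assms(1) that(2) m(1)] that(1) m(2) assms(2,3) by metis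
  then have "{v. p v = y \<and> f v = 0} = {v. p v = y} - {m}"
    using m by blast
  then show ?thesis using True m kids[OF assms(2)] finite_kids[OF assms(2)] by simp
next
  case False
  then have "{v. p v = y \<and> f v = 0} = {v. p v = y}"
    using assms by (auto simp: marked_def)
  then show ?thesis using False kids[OF assms(2)] by simp
qed

section \<open>Extending a piece by preimages and by 2-cycles\<close>

text \<open>The newly assigned vertices all have their parents in \<open>Q\<close>, and these now
  have preimages. So no mark arises, and the marks in \<open>Q\<close> vanish.\<close>

lemma fill:
  assumes f: "piece f"
    and Q': "\<forall>y\<in>Q. f y \<noteq> 0 \<and> y \<notin> range f"
    and K': "\<forall>v\<in>K. f v = 0 \<and> p v \<in> Q"
    and card': "\<forall>y\<in>Q. card {v \<in> K. p v = y} = d - 1"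
    and g: "g = (\<lambda>v. if v \<in> K then p v else f v)"
  shows "extends f g" "piece g" "x \<noteq> 0 \<Longrightarrow> x \<in> range g \<longleftrightarrow> x \<in> range f \<or> x \<in> Q"
    "marked g y \<longleftrightarrow> marked f y \<and> y \<notin> Q"
proof -
  note Q = bspec[OF Q'] and K = bspec[OF K'] and card = bspec[OF card']
  have Q0: "0 \<notin> Q" using Q[of 0] core_0[OF f] by auto
  have K0: "0 \<notin> K" using K p0 Q0 by metis
  show e: "extends f g" unfolding extends_def g using K by auto
  have pK: "p v \<noteq> 0" if "v \<in> K" for v using K[OF that] Q0 by metis
  have g0: "g v = 0 \<longleftrightarrow> f v = 0 \<and> v \<notin> K" for v using K[of v] pK[of v]
    unfolding g by auto
  have ne: "\<exists>v\<in>K. p v = y" if "y \<in> Q" for y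
  proof -
    have "card {v \<in> K. p v = y} \<noteq> 0" using card[OF that] d by simp
    then have "{v \<in> K. p v = y} \<noteq> {}" by (metis card.empty)
    then show ?thesis by blast
  qed
  show r: "x \<in> range g \<longleftrightarrow> x \<in> range f \<or> x \<in> Q" if "x \<noteq> 0" for x
  proof
    assume "x \<in> range g"
    then show "x \<in> range f \<or> x \<in> Q" unfolding g using K by auto
  next
    assume "x \<in> range f \<or> x \<in> Q"
    then show "x \<in> range g"
    proof
      assume "x \<in> range f"
      then show ?thesis using range_extends[OF f e] g0[of 0] core_0[OF f] K0 by simp
    next
      assume "x \<in> Q"
      with ne obtain v where "v \<in> K" "p v = x" by blast
      then have "g v = x" unfolding g by simp
      then show ?thesis by blast
    qed
  qed
  have fin: "finite K"
  proof (rule finite_subset)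
    show "K \<subseteq> (\<Union>y\<in>Q. {v. p v = y})" using K by auto
    have "finite Q" by (rule finite_subset[OF _ piece_fin[OF f]]) (use Q in auto)
    then show "finite (\<Union>y\<in>Q. {v. p v = y})" using finite_kids Q0
      by (intro finite_UN_I) metis+
  qed
  show m: "marked g y \<longleftrightarrow> marked f y \<and> y \<notin> Q" for y
  proof
    assume "marked g y"
    then obtain m where "y \<noteq> 0" "y \<notin> range g" "g m \<noteq> 0" "p m = y"
      by (auto simp: marked_def)
    with r[of y] K[of m] g0[of m] show "marked f y \<and> y \<notin> Q" by (auto simp: marked_def)
  next
    assume y: "marked f y \<and> y \<notin> Q"
    then obtain m where "f m \<noteq> 0" "p m = y" unfolding marked_def by blast
    then have "g m \<noteq> 0" using g0[of m] by simp
    then show "marked g y" using y \<open>p m = y\<close> r[of y] unfolding marked_def by blast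
  qed
  show "piece g"
    unfolding piece_def
  proof (intro conjI allI impI)
    show "finite {v. g v \<noteq> 0}"
      by (rule finite_subset[of _ "{v. f v \<noteq> 0} \<union> K"]) (use piece_fin[OF f] fin g0 in auto)
    show "g 0 = 0" using g0 K0 core_0[OF f] by blast
  next
    fix v assume v: "g v \<noteq> 0"
    show "g (g v) \<noteq> 0"
    proof (cases "v \<in> K")
      case True
      then have "g v = p v" by (simp add: g)
      then show ?thesis using K[OF True] Q[of "p v"] g0[of "p v"] by simp
    next
      case False
      then have "g v = f v" "f v \<noteq> 0" using v by (auto simp: g)
      then show ?thesis using piece_step[OF f, of v] g0 by auto
    qed
    show "g v = p v \<or> p (g v) = v"
      using v piece_edge[OF f, of v] unfolding g by (auto split: if_splits)
    show "card {w. g w = g v} = d - 1"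
    proof (cases "v \<in> K")
      case True
      then have "p v \<in> Q" using K by blast
      then have "f w \<noteq> p v" for w using Q by (metis rangeI)
      then have "{w. g w = g v} = {w \<in> K. p w = p v}" using True unfolding g by auto
      then show ?thesis using card[OF \<open>p v \<in> Q\<close>] by simp
    next
      case False
      then have fv: "f v \<noteq> 0" "f v \<notin> Q" using v Q by (auto simp: g)
      then have "g w = f v \<longleftrightarrow> f w = f v" for w using K[of w]
        by (cases "w \<in> K") (auto simp: g)
      then have "{w. g w = f v} = {w. f w = f v}" by simp
      moreover have gv: "g v = f v" using False by (simp add: g)
      ultimately show ?thesis using piece_card[OF f fv(1)] unfolding gv by simp
    qed
  next
    fix m m' assume *: "g m \<noteq> 0" "g m' \<noteq> 0" "p m = p m'" "p m \<noteq> 0" "p m \<notin> range g"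
    then have "m \<notin> K" "m' \<notin> K" using r[of "p m"] K by metis+
    then show "m = m'" using * r[of "p m"] piece_one[OF f, of m m'] g0 by auto
  qed
qed

text \<open>The preimages of \<open>a\<close> are \<open>b\<close> and \<open>d - 2\<close> other
  children, those of \<open>b\<close> are \<open>a\<close> and \<open>d - 2\<close> children. Except
  for \<open>a\<close>, every newly assigned vertex has \<open>a\<close> or \<open>b\<close> as
  parent, so only \<open>p a\<close> can become marked; \<open>pa\<close> ensures that it does not
  get a second assigned child while lacking preimages.\<close>

lemma two_cycle:
  assumes f: "piece f" and ab: "a \<noteq> 0" "f a = 0" "f b = 0" "p b = a"
    and pa: "\<not> marked f (p a) \<or> p a = b"
    and K': "\<forall>v\<in>K. f v = 0 \<and> (p v = a \<or> p v = b) \<and> v \<noteq> a"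
    and bK: "b \<in> K"
    and cards: "card {v \<in> K. p v = a} = d - 1" "card {v \<in> K. p v = b} = d - 2"
    and g: "g = (\<lambda>v. if v = a then b else if v \<in> K then p v else f v)"
  shows "extends f g" "piece g" "x \<noteq> 0 \<Longrightarrow> x \<in> range g \<longleftrightarrow> x \<in> range f \<or> x = a \<or> x = b"
    "marked g y \<Longrightarrow> (marked f y \<or> y = p a) \<and> y \<noteq> a \<and> y \<noteq> b"
    "f v = 0 \<Longrightarrow> g v \<noteq> 0 \<Longrightarrow> two_cyclic_after 1 g v"
    "g a = b" "g b = a"
proof -
  note K = bspec[OF K']
  have b0: "b \<noteq> 0" using ab p0 by metis
  have neq: "a \<noteq> b" using noloop[OF b0] ab by auto
  have pK: "p v \<noteq> 0" if "v \<in> K" for v using K[OF that] ab b0 by metis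
  have K0: "0 \<notin> K" using K[of 0] ab b0 by auto
  have nr: "a \<notin> range f" "b \<notin> range f" using piece_range[OF f] ab b0 by blast+
  then have nf: "f w \<noteq> a" "f w \<noteq> b" for w by (metis rangeI)+
  show e: "extends f g" unfolding extends_def g using K ab by auto
  have g0: "g v = 0 \<longleftrightarrow> f v = 0 \<and> v \<notin> K \<and> v \<noteq> a" for v
    using K[of v] pK[of v] ab b0 unfolding g by auto
  show gab: "g a = b" "g b = a" using bK ab neq by (auto simp: g)
  show r: "x \<in> range g \<longleftrightarrow> x \<in> range f \<or> x = a \<or> x = b" if "x \<noteq> 0" for x
  proof
    assume "x \<in> range g"
    then show "x \<in> range f \<or> x = a \<or> x = b" unfolding g using K by auto
  next
    assume "x \<in> range f \<or> x = a \<or> x = b"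
    then show "x \<in> range g"
      using range_extends[OF f e] g0[of 0] core_0[OF f] K0 ab(1) gab by (metis rangeI)
  qed
  have fin: "finite K"
  proof (rule finite_subset)
    show "K \<subseteq> {v. p v = a} \<union> {v. p v = b}" using K by auto
    show "finite ({v. p v = a} \<union> {v. p v = b})" using finite_kids ab b0 by simp
  qed
  show m: "(marked f y \<or> y = p a) \<and> y \<noteq> a \<and> y \<noteq> b" if mky: "marked g y" for y
  proof -
    obtain m where m: "y \<noteq> 0" "y \<notin> range g" "g m \<noteq> 0" "p m = y" using mky
      unfolding marked_def by blast
    with r[of y] have "y \<notin> range f" "y \<noteq> a" "y \<noteq> b" by auto
    with m K[of m] g0[of m] show ?thesis by (auto simp: marked_def)
  qed
  show "two_cyclic_after 1 g v" if "f v = 0" "g v \<noteq> 0"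
  proof -
    have "g v = a \<or> g v = b" using that K[of v] unfolding g by (auto split: if_splits)
    moreover have "two_cyclic_after 0 g a" "two_cyclic_after 0 g b"
      by (simp_all add: two_cyclic_after_def gab numeral_2_eq_2)
    ultimately have "two_cyclic_after 0 g (g v)" by metis
    then show ?thesis using two_cyclic_after_Suc by simp
  qed
  show "piece g"
    unfolding piece_def
  proof (intro conjI allI impI)
    show "finite {v. g v \<noteq> 0}"
      by (rule finite_subset[of _ "insert a ({v. f v \<noteq> 0} \<union> K)"]) (use piece_fin[OF f] fin g0 in auto)
    show "g 0 = 0" using g0 K0 core_0[OF f] ab by auto
  next
    fix v assume v: "g v \<noteq> 0"
    consider "v = a" | "v \<noteq> a" "v \<in> K" | "v \<noteq> a" "v \<notin> K" by blast
    then have "g (g v) \<noteq> 0 \<and> (g v = p v \<or> p (g v) = v) \<and> card {w. g w = g v} = d - 1"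
    proof cases
      case 1
      have "{w. g w = b} = insert a {w \<in> K. p w = b}"
        using nf neq unfolding g by auto
      moreover have "a \<notin> {w \<in> K. p w = b}" using K by blast
      ultimately have "card {w. g w = b} = d - 1" using cards fin d by simp
      then show ?thesis using 1 gab ab by simp
    next
      case 2
      then have gv: "g v = p v" by (simp add: g)
      have "card {w. g w = p v} = d - 1"
      proof (cases "p v = a")
        case True
        then have "{w. g w = p v} = {w \<in> K. p w = a}"
          using nf neq K[of a] unfolding g by auto
        then show ?thesis using cards by simp
      next
        case False
        then have "p v = b" using K 2 by blast
        moreover have "{w. g w = b} = insert a {w \<in> K. p w = b}"
          using nf neq unfolding g by auto
        moreover have "a \<notin> {w \<in> K. p w = b}" using K by blast
        ultimately show ?thesis using cards fin d by simp
      qed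
      moreover have "g (p v) \<noteq> 0" using K[OF 2(2)] gab ab b0 by auto
      ultimately show ?thesis using gv by simp
    next
      case 3
      then have gv: "g v = f v" "f v \<noteq> 0" using v by (auto simp: g)
      then have "f v \<noteq> a" "f v \<noteq> b" using nr by auto
      then have "g w = f v \<longleftrightarrow> f w = f v" for w
        using K[of w] ab gv(2) by (cases "w \<in> K") (auto simp: g)
      then have "{w. g w = f v} = {w. f w = f v}" by simp
      moreover have "g (f v) \<noteq> 0" using piece_step[OF f gv(2)] g0 by auto
      ultimately show ?thesis using gv piece_card[OF f gv(2)] piece_edge[OF f gv(2)] by simp
    qed
    then show "g (g v) \<noteq> 0" "g v = p v \<or> p (g v) = v" "card {w. g w = g v} = d - 1"
      by blast+
  next
    fix m m' assume *: "g m \<noteq> 0" "g m' \<noteq> 0" "p m = p m'" "p m \<noteq> 0" "p m \<notin> range g"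
    then have n: "p m \<notin> range f" "p m \<noteq> a" "p m \<noteq> b" using r by auto
    then have "m \<notin> K" "m' \<notin> K" using K * by metis+
    then have B: "f m \<noteq> 0 \<or> m = a" "f m' \<noteq> 0 \<or> m' = a" 
      using *(1,2) g0[of m] g0[of m'] by auto
    \<comment> \<open>Here \<open>p a\<close> has no preimages and was not marked, so none of its
      children was assigned before; \<open>a\<close> is the only one assigned now.\<close>
    have nm: "f w = 0" if "p m = p a" "p w = p a" for w
      using pa n that *(4) unfolding marked_def by metis
    show "m = m'"
    proof (cases "m = a \<or> m' = a")
      case True
      then show ?thesis using B nm *(3) by metis
    next
      case False
      then show ?thesis using B piece_one[OF f _ _ *(3,4) n(1)] by blast
    qed
  qed
qed

text \<open>Even if marked, \<open>a\<close> and \<open>b\<close> have \<open>d - 1\<close> free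
  children each. Setting aside \<open>b\<close> on one side and, in case \<open>p a = b\<close>,
  \<open>a\<close> on the other leaves \<open>d - 2\<close>, as many as the 2-cycle still
  needs.\<close>

lemma two_cycle_ex:
  assumes f: "piece f" and ab: "a \<noteq> 0" "f a = 0" "f b = 0" "p b = a"
    and pa: "\<not> marked f (p a) \<or> p a = b"
  shows "\<exists>g. extends f g \<and> piece g \<and> a \<in> range g \<and> b \<in> range g \<and> g a = b \<and> g b = a \<and>
    (\<forall>y. marked g y \<longrightarrow> (marked f y \<or> y = p a) \<and> y \<noteq> a \<and> y \<noteq> b) \<and>
    (\<forall>v. f v = 0 \<longrightarrow> g v \<noteq> 0 \<longrightarrow> two_cyclic_after 1 g v)"
proof -
  have b0: "b \<noteq> 0" using ab p0 by metis
  have neq: "a \<noteq> b" using noloop[OF b0] ab by auto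
  have nr: "a \<notin> range f" "b \<notin> range f" using piece_range[OF f] ab b0 by blast+
  let ?A = "{v. p v = a \<and> f v = 0}" and ?B = "{v. p v = b \<and> f v = 0}"
  have fin: "finite ?A" "finite ?B" using finite_kids ab b0 by auto
  have "d - 1 \<le> card ?A" "d - 1 \<le> card ?B"
    using card_free_kids[OF f] ab b0 nr by auto
  then have "d - 2 \<le> card (?A - {b})" "d - 2 \<le> card (?B - {a})"
    using fin by (auto simp: card_Diff_singleton_if)
  then obtain K1 K2 where K1: "K1 \<subseteq> ?A - {b}" "card K1 = d - 2" and K2: "K2 \<subseteq> ?B - {a}" "card K2 = d - 2"
    by (meson obtain_subset_with_card_n)
  define K where "K = insert b (K1 \<union> K2)"
  have "{v \<in> K. p v = a} = insert b K1" "{v \<in> K. p v = b} = K2"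
    using K1(1) K2(1) ab neq unfolding K_def by auto
  moreover have "b \<notin> K1" "finite K1" using K1 fin finite_subset by auto
  ultimately have cards: "card {v \<in> K. p v = a} = d - 1" "card {v \<in> K. p v = b} = d - 2"
    using K1 K2 d by auto
  have K: "\<forall>v\<in>K. f v = 0 \<and> (p v = a \<or> p v = b) \<and> v \<noteq> a"
    using K1(1) K2(1) ab neq noloop[OF ab(1)] unfolding K_def by auto
  have bK: "b \<in> K" unfolding K_def by simp
  define g where "g = (\<lambda>v. if v = a then b else if v \<in> K then p v else f v)"
  note * = two_cycle[OF f ab pa K bK cards g_def]
  show ?thesis
  proof (intro exI[of _ g] conjI allI impI)
    show "a \<in> range g" "b \<in> range g" using *(6,7) by (metis rangeI)+
    show "marked f y \<or> y = p a" "y \<noteq> a" "y \<noteq> b" if "marked g y" for y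
      using *(4)[OF that] by blast+
    show "two_cyclic_after 1 g v" if "f v = 0" "g v \<noteq> 0" for v using *(5) that by blast
  qed (rule *)+
qed

text \<open>All marked assigned vertices other than \<open>q\<close> receive their preimages at
  once. One round is enough: a newly assigned vertex that is itself marked would have a marked
  parent, against separation.\<close>

lemma settle:
  assumes f: "piece f" "separated q f" and k: "all_two_cyclic_after k f" "0 < k"
    and new: "\<And>y. marked f y \<Longrightarrow> f y \<noteq> 0 \<Longrightarrow> y \<noteq> q \<Longrightarrow> two_cyclic_after (k - 1) f y"
  shows "\<exists>g. extends f g \<and> piece g \<and> separated q g \<and> unassigned q g \<and> all_two_cyclic_after k g \<and>
    (\<forall>y. marked g y \<longrightarrow> marked f y) \<and> (\<forall>v. g v \<noteq> 0 \<longrightarrow> f v \<noteq> 0 \<or> marked f (p v))"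
proof -
  define Q where "Q = {y. marked f y \<and> f y \<noteq> 0 \<and> y \<noteq> q}"
  define K where "K = {v. f v = 0 \<and> p v \<in> Q}"
  define g where "g = (\<lambda>v. if v \<in> K then p v else f v)"
  have Q: "\<forall>y\<in>Q. f y \<noteq> 0 \<and> y \<notin> range f"
    by (auto simp: Q_def marked_def)
  have K: "\<forall>v\<in>K. f v = 0 \<and> p v \<in> Q" by (simp add: K_def)
  have card: "\<forall>y\<in>Q. card {v \<in> K. p v = y} = d - 1"
  proof
    fix y assume that: "y \<in> Q"
    have "{v \<in> K. p v = y} = {v. p v = y \<and> f v = 0}" using that by (auto simp: K_def)
    moreover have "marked f y" using that by (simp add: Q_def)
    ultimately show "card {v \<in> K. p v = y} = d - 1"
      using card_free_kids[OF f(1), of y] by (simp add: marked_def)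
  qed
  note n = fill[OF f(1) Q K card g_def]
  have "separated q g" using f(2) unfolding separated_def n(4) by blast
  moreover have "unassigned q g"
    unfolding unassigned_def
  proof (intro allI impI)
    fix y assume y: "marked g y"
    then have y': "marked f y" "y \<notin> Q" using n(4) by blast+
    show "g y = 0 \<or> y = q"
    proof (rule ccontr)
      assume "\<not> (g y = 0 \<or> y = q)"
      then have "p y \<in> Q" "y \<noteq> q" using y'
        by (auto simp: g_def K_def Q_def split: if_splits)
      then have "marked f (p y)" "p y \<noteq> q" by (simp_all add: Q_def)
      then show False using separatedD[OF f(2) y'(1)] \<open>y \<noteq> q\<close> by blast
    qed
  qed
  moreover have "all_two_cyclic_after k g"
    unfolding all_two_cyclic_after_def
  proof (intro allI impI)
    fix v assume v: "g v \<noteq> 0"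
    show "two_cyclic_after k g v"
    proof (cases "v \<in> K")
      case True
      then have "p v \<in> Q" "g v = p v" using K by (auto simp: g_def)
      then have "two_cyclic_after (k - 1) g (g v)"
        using two_cyclic_after_extends[OF f(1) n(1)] new by (auto simp: Q_def)
      then show ?thesis using two_cyclic_after_Suc[of "k - 1" g v] k by simp
    next
      case False
      then show ?thesis using v two_cyclic_after_extends[OF f(1) n(1)] k
        by (auto simp: g_def all_two_cyclic_after_def)
    qed
  qed
  moreover have "\<forall>v. g v \<noteq> 0 \<longrightarrow> f v \<noteq> 0 \<or> marked f (p v)"
    by (auto simp: g_def K_def Q_def)
  ultimately show ?thesis using n(1,2,4) by (intro exI[of _ g]) blast
qed

text \<open>The new preimages are one step further away from a 2-cycle. An unmarked \<open>x\<close>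
  has a child to spare, so one vertex can be kept as it was; \<open>avoid = 0\<close> asks for
  nothing, as \<open>0\<close> is not a child of \<open>x\<close>.\<close>

lemma fill_one:
  assumes f: "piece f" and x: "f x \<noteq> 0" "x \<notin> range f" and k: "all_two_cyclic_after k f"
    and avoid: "marked f x \<Longrightarrow> avoid = 0"
  shows "\<exists>g. extends f g \<and> piece g \<and> x \<in> range g \<and> all_two_cyclic_after (Suc k) g \<and> (\<forall>y. marked g y \<longleftrightarrow> marked f y \<and> y \<noteq> x)
    \<and> g avoid = f avoid"
proof -
  have x0: "x \<noteq> 0" using x core_0[OF f] by auto
  let ?A = "{v. p v = x \<and> f v = 0}"
  have fin: "finite ?A" using finite_kids[OF x0] by simp
  have "d - 1 \<le> card (?A - {avoid})"
    using card_free_kids[OF f x0 x(2)] fin avoid x0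
      by (auto simp: card_Diff_singleton_if split: if_splits)
  then obtain K where K: "K \<subseteq> ?A - {avoid}" "card K = d - 1"
    by (meson obtain_subset_with_card_n)
  define g where "g = (\<lambda>v. if v \<in> K then p v else f v)"
  have "{v \<in> K. p v = x} = K" using K(1) by auto
  then have "\<forall>y\<in>{x}. f y \<noteq> 0 \<and> y \<notin> range f" "\<forall>v\<in>K. f v = 0 \<and> p v \<in> {x}"
    "\<forall>y\<in>{x}. card {v \<in> K. p v = y} = d - 1"
    using x K by auto
  note n = fill[OF f this g_def]
  have "all_two_cyclic_after (Suc k) g"
    unfolding all_two_cyclic_after_def
  proof (intro allI impI)
    fix v assume v: "g v \<noteq> 0"
    show "two_cyclic_after (Suc k) g v"
    proof (cases "v \<in> K")
      case True
      then have "g v = x" using K by (auto simp: g_def)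
      then have "two_cyclic_after k g (g v)"
        using two_cyclic_after_extends[OF f n(1)] x k by (auto simp: all_two_cyclic_after_def)
      then show ?thesis by (rule two_cyclic_after_Suc)
    next
      case False
      then have "two_cyclic_after k g v" using v two_cyclic_after_extends[OF f n(1)] k
        by (auto simp: g_def all_two_cyclic_after_def)
      then show ?thesis by (rule two_cyclic_after_mono) simp
    qed
  qed
  moreover have "g avoid = f avoid" using K by (auto simp: g_def)
  moreover have "x \<in> range g" using n(3)[OF x0] by blast
  moreover have "\<forall>y. marked g y \<longleftrightarrow> marked f y \<and> y \<noteq> x"
    using n(4) by blast
  ultimately show ?thesis using n(1,2) by (intro exI[of _ g] conjI)
qed

text \<open>The exception moves from \<open>q\<close> to \<open>p a\<close>: a nonzero
  \<open>q\<close> is on the new 2-cycle and so loses its mark, and only \<open>p a\<close> can gain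
  one. New vertices are one step from the 2-cycle and those added by \<open>settle\<close> two, so
  the bound \<open>k\<close> survives if \<open>2 \<le> k\<close>.\<close>

lemma two_cycle_settle:
  assumes f: "piece f" "separated q f" "unassigned q f" and q: "q = 0 \<or> q = a \<or> q = b"
    and k: "all_two_cyclic_after k f" "2 \<le> k"
    and ab: "a \<noteq> 0" "f a = 0" "f b = 0" "p b = a"
    and pa: "\<not> marked f (p a) \<or> p a = b"
  shows "\<exists>g. extends f g \<and> piece g \<and> separated (p a) g \<and> unassigned (p a) g \<and> all_two_cyclic_after k g \<and>
    a \<in> range g \<and> b \<in> range g \<and> (\<forall>y. marked g y \<longrightarrow> (marked f y \<or> y = p a) \<and> y \<noteq> a \<and> y \<noteq> b) \<and>
    g a = b \<and> g b = a"
proof -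
  obtain h where h: "extends f h" "piece h" "a \<in> range h" "b \<in> range h" "h a = b" "h b = a"
    and marked: "\<And>y. marked h y \<Longrightarrow> (marked f y \<or> y = p a) \<and> y \<noteq> a \<and> y \<noteq> b"
    and new: "\<And>v. f v = 0 \<Longrightarrow> h v \<noteq> 0 \<Longrightarrow> two_cyclic_after 1 h v"
    using two_cycle_ex[OF f(1) ab pa] by blast
  have b0: "b \<noteq> 0" using ab p0 by metis
  have "separated (p a) h"
    unfolding separated_def
  proof (intro allI impI)
    fix y assume y: "marked h y" "marked h (p y)"
    then have "y \<noteq> 0" "p y \<noteq> 0" by (simp_all add: marked_def)
    then have nq: "y \<noteq> q" "p y \<noteq> q" using marked[OF y(1)] marked[OF y(2)] q by metis+
    show "y = p a \<or> p y = p a"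
    proof (rule ccontr)
      assume "\<not> (y = p a \<or> p y = p a)"
      then have "marked f y" "marked f (p y)" using marked[OF y(1)] marked[OF y(2)] by simp_all
      from separatedD[OF f(2) this] nq show False by simp
    qed
  qed
  moreover have "all_two_cyclic_after k h"
    unfolding all_two_cyclic_after_def
  proof (intro allI impI)
    fix v assume v: "h v \<noteq> 0"
    show "two_cyclic_after k h v"
    proof (cases "f v = 0")
      case True
      then show ?thesis using two_cyclic_after_mono[OF new[OF True v], of k] k(2) by simp
    next
      case False
      then show ?thesis using two_cyclic_after_extends[OF f(1) h(1) False] k(1)
        by (simp add: all_two_cyclic_after_def)
    qed
  qed
  moreover have "two_cyclic_after (k - 1) h y" if "marked h y" "h y \<noteq> 0" "y \<noteq> p a" for y
  proof -
    have "y \<noteq> 0" using that(1) by (simp add: marked_def)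
    then have "y \<noteq> q" using marked[OF that(1)] q by metis
    then have "f y = 0" using marked[OF that(1)] unassignedD[OF f(3)] that(3) by metis
    then have "two_cyclic_after 1 h y" using new that by blast
    then show ?thesis by (rule two_cyclic_after_mono) (use k in simp)
  qed
  ultimately obtain g where g: "extends h g" "piece g" "separated (p a) g" "unassigned (p a) g" "all_two_cyclic_after k g"
      "\<forall>y. marked g y \<longrightarrow> marked h y"
    using settle[OF h(2), of "p a" k] k by auto
  have "g a = b" "g b = a" using g(1) h ab b0 by (auto simp: extends_def)
  then show ?thesis
    using g h(1) marked extends_trans by (intro exI[of _ g]) (metis rangeI)
qed

text \<open>Each 2-cycle removes two marks for at most one new one and keeps \<open>k\<close>. The
  increase by two occurs only at the end, if \<open>q\<close> is assigned: one step for the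
  preimages of \<open>q\<close>, one for the preimages of those among them that are marked.\<close>

lemma cascade:
  assumes "piece f" "separated q f" "unassigned q f" "all_two_cyclic_after k f" "2 \<le> k"
  shows "\<exists>g. extends f g \<and> good g \<and> all_two_cyclic_after (k + 2) g"
  using assms
proof (induction "card {y. marked f y}" arbitrary: f q rule: less_induct)
  case less
  note f = less.prems(1-3) and k = less.prems(4,5)
  have separated0: "separated 0 h" if "\<And>y. marked h y \<Longrightarrow> \<not> marked h (p y)" for h
    using that by (auto simp: separated_def)
  consider (assigned) "marked f q" "f q \<noteq> 0"
    | (settled) "f q = 0 \<or> \<not> marked f q" "\<And>y. marked f y \<Longrightarrow> \<not> marked f (p y)"
    | (bad) "f q = 0 \<or> \<not> marked f q" "\<exists>y. marked f y \<and> marked f (p y)"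
      by metis
  then show ?case
  proof cases
    case assigned
    obtain h where h: "extends f h" "piece h" "all_two_cyclic_after (Suc k) h" "\<And>y. marked h y \<longleftrightarrow> marked f y \<and> y \<noteq> q"
      using fill_one[OF f(1) assigned(2) _ k(1), where avoid = 0] assigned
        by (auto simp: marked_def)
    have s: "separated 0 h" using separatedD[OF f(2)] h(4) by (intro separated0) metis
    obtain g where "extends h g" "piece g" "separated 0 g" "unassigned 0 g" "all_two_cyclic_after (k + 2) g"
      using settle[OF h(2) s, of "k + 2"] all_two_cyclic_after_mono[OF h(3), of "k + 2"] h(3)
        by (auto simp: all_two_cyclic_after_def)
    then show ?thesis using h(1) extends_trans unfolding good_def by blast
  next
    case settled
    have "unassigned 0 f" using unassignedD[OF f(3)] settled unfolding unassigned_def by metis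
    then show ?thesis
      using f separated0[OF settled(2)] all_two_cyclic_after_mono[OF k(1)] unfolding good_def
        by (intro exI[of _ f]) auto
  next
    case bad
    have un: "f y = 0" if "marked f y" for y using that unassignedD[OF f(3)] bad(1) by metis
    obtain y where y: "marked f y" "marked f (p y)" using bad(2) by blast
    then have yq: "y = q \<or> p y = q" by (rule separatedD[OF f(2)])
    \<comment> \<open>The pair is taken above \<open>q\<close> if possible and below it otherwise,
      so that the parent of its upper vertex is unmarked or is the lower vertex.\<close>
    obtain a b where ab: "marked f a" "marked f b" "p b = a" "q = a \<or> q = b" "\<not> marked f (p a) \<or> p a = b"
    proof (cases "marked f (p q)")
      case True
      have "marked f q" using y yq by auto
      have "p q \<noteq> q" using True noloop[of q] by (auto simp: marked_def)
      then have "\<not> marked f (p (p q)) \<or> p (p q) = q" using separatedD[OF f(2) True]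
        by metis
      then show ?thesis using that[of "p q" q] True \<open>marked f q\<close> by blast
    next
      case False
      then have "p y = q" using y yq by auto
      then show ?thesis using that[of q y] y False by auto
    qed
    have a0: "a \<noteq> 0" using ab by (auto simp: marked_def)
    obtain h where h: "extends f h" "piece h" "separated (p a) h" "unassigned (p a) h" "all_two_cyclic_after k h"
      and mkh: "\<forall>y. marked h y \<longrightarrow> (marked f y \<or> y = p a) \<and> y \<noteq> a \<and> y \<noteq> b"
      using two_cycle_settle[OF f _ k a0 un[OF ab(1)] un[OF ab(2)] ab(3) ab(5)] ab(4) by blast
    have "a \<noteq> b" using ab noloop[of b] by (auto simp: marked_def)
    have "{y. marked h y} \<subseteq> insert (p a) ({y. marked f y} - {a, b})" using mkh by auto
    then have "card {y. marked h y} \<le> card (insert (p a) ({y. marked f y} - {a, b}))"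
      using finite_marked[OF f(1)] by (intro card_mono) auto
    also have "\<dots> \<le> Suc (card ({y. marked f y} - {a, b}))" by (rule card_insert_le_m1) auto
    also have "card ({y. marked f y} - {a, b}) = card {y. marked f y} - 2"
      using ab \<open>a \<noteq> b\<close> finite_marked[OF f(1)] by (subst card_Diff_subset) auto
    also have "Suc (card {y. marked f y} - 2) < card {y. marked f y}"
    proof -
      have "card {a, b} \<le> card {y. marked f y}" using ab finite_marked[OF f(1)]
        by (intro card_mono) auto
      then show ?thesis using \<open>a \<noteq> b\<close> by simp
    qed
    finally obtain g where "extends h g" "good g" "all_two_cyclic_after (k + 2) g"
      using less.hyps[OF _ h(2-5) k(2)] by blast
    then show ?thesis using h(1) extends_trans by blast
  qed
qed

lemma extend:
  assumes f: "good f" and k: "all_two_cyclic_after k f" "2 \<le> k" and x: "x \<noteq> 0"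
  shows "\<exists>g. extends f g \<and> good g \<and> all_two_cyclic_after (k + 2) g \<and> x \<in> range g"
proof -
  have c: "piece f" "separated 0 f" "unassigned 0 f" using f by (auto simp: good_def)
  have mono: "x \<in> range h" if "x \<in> range g" "extends g h" "piece g" "good h" for g h
    using that range_extends core_0 good_def by metis
  have settle0: "\<exists>g. extends h g \<and> good g \<and> all_two_cyclic_after (k + 2) g \<and> (\<forall>v. g v \<noteq> 0 \<longrightarrow> h v \<noteq> 0 \<or> marked h (p v))"
    if "piece h" "separated 0 h" "all_two_cyclic_after (Suc k) h" for h
    using settle[OF that(1,2), of "k + 2"] all_two_cyclic_after_mono[OF that(3), of "k + 2"] that(3)
    by (auto simp: all_two_cyclic_after_def good_def)
  \<comment> \<open>If \<open>p x\<close> is missing or already has its preimages, a 2-cycle of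
    \<open>x\<close> with a free child creates no mark above \<open>x\<close>, and no cascade
    follows.\<close>
  have main: "\<exists>g. extends h g \<and> good g \<and> all_two_cyclic_after (k + 2) g \<and> x \<in> range g"
    if h: "good h" "all_two_cyclic_after (k + 2) h" "h x = 0" "p x = 0 \<or> p x \<in> range h" for h
  proof -
    have hc: "piece h" "separated 0 h" "unassigned 0 h" using h by (auto simp: good_def)
    have "card {v. p v = x \<and> h v = 0} \<noteq> 0"
      using card_free_kids[OF hc(1) x piece_range[OF hc(1) h(3) x]] d by auto
    then obtain z where z: "p z = x" "h z = 0"
      by (metis (mono_tags, lifting) card.empty empty_Collect_eq)
    have npx: "\<not> marked h' (p x)" if "piece h'" "extends h h'" for h'
      using h(4) range_extends[OF hc(1) that(2) core_0[OF that(1)]] by (auto simp: marked_def)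
    obtain g where g: "extends h g" "piece g" "separated (p x) g" "unassigned (p x) g" "all_two_cyclic_after (k + 2) g" "x \<in> range g"
      using two_cycle_settle[OF hc _ h(2) _ x h(3) z(2,1)] npx[OF hc(1)] by auto
    then have "\<not> marked g (p x)" using npx by blast
    then have "good g" using g(2-4) unfolding good_def separated_def unassigned_def by metis
    then show ?thesis using g by blast
  qed
  consider "x \<in> range f" | "x \<notin> range f" "f x \<noteq> 0" | "f x = 0" "p x = 0 \<or> p x \<in> range f"
    | "f x = 0" "p x \<noteq> 0" "p x \<notin> range f" "f (p x) \<noteq> 0"
    | "f x = 0" "p x \<noteq> 0" "p x \<notin> range f" "f (p x) = 0" by blast
  then show ?thesis
  proof cases
    case 1
    then show ?thesis using f all_two_cyclic_after_mono[OF k(1)] by (intro exI[of _ f]) auto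
  next
    case 2
    obtain h where h: "extends f h" "piece h" "x \<in> range h" "all_two_cyclic_after (Suc k) h" "\<forall>y. marked h y \<longleftrightarrow> marked f y \<and> y \<noteq> x"
      using fill_one[OF c(1) 2(2,1) k(1), where avoid = 0] by auto
    then have "separated 0 h" using c(2) by (simp add: separated_def)
    then show ?thesis using settle0[OF h(2) _ h(4)] h mono extends_trans by meson
  next
    case 3
    then show ?thesis using main[OF f all_two_cyclic_after_mono[OF k(1)]] by simp
  next
    case 4
    \<comment> \<open>Assigned vertices of a good piece are unmarked, so \<open>p x\<close> can
      receive its preimages while sparing \<open>x\<close>; afterwards \<open>main\<close>
      applies.\<close>
    have "\<not> marked f (p x)" using unassignedD[OF c(3), of "p x"] 4 by metis
    then obtain h where h: "extends f h" "piece h" "p x \<in> range h" "all_two_cyclic_after (Suc k) h"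
        "\<forall>y. marked h y \<longleftrightarrow> marked f y \<and> y \<noteq> p x" "h x = f x"
      using fill_one[OF c(1) 4(4,3) k(1), where avoid = x] by auto
    then have "separated 0 h" using c(2) by (simp add: separated_def)
    then obtain g where g: "extends h g" "good g" "all_two_cyclic_after (k + 2) g" "\<forall>v. g v \<noteq> 0 \<longrightarrow> h v \<noteq> 0 \<or> marked h (p v)"
      using settle0[OF h(2) _ h(4)] by blast
    have "p x \<in> range g" using range_extends[OF h(2) g(1) _ h(3)] g(2) core_0
      by (simp add: good_def)
    \<comment> \<open>Settling assigns only children of marked vertices, and \<open>p x\<close> is
      no longer one, so \<open>x\<close> is still free.\<close>
    moreover have "g x = 0" using g(4) h 4 by auto
    ultimately show ?thesis using main[OF g(2,3)] g(1) h(1) extends_trans by blast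
  next
    case 5
    \<comment> \<open>If \<open>p x\<close> is marked, separation leaves \<open>p (p x)\<close>
      unmarked and \<open>p x\<close> can join \<open>x\<close>; otherwise \<open>x\<close> joins a
      free child.\<close>
    have "\<exists>a b. a \<noteq> 0 \<and> f a = 0 \<and> f b = 0 \<and> p b = a \<and> \<not> marked f (p a) \<and> (a = x \<or> b = x)"
    proof (cases "marked f (p x)")
      case True
      then have "\<not> marked f (p (p x))" using separatedD[OF c(2) True] 5(2) unfolding marked_def
        by metis
      then show ?thesis using 5 by blast
    next
      case False
      have "card {v. p v = x \<and> f v = 0} \<noteq> 0"
        using card_free_kids[OF c(1) x piece_range[OF c(1) 5(1) x]] d by auto
      then obtain z where "p z = x" "f z = 0"
        by (metis (mono_tags, lifting) card.empty empty_Collect_eq)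
      then show ?thesis using x 5(1) False by blast
    qed
    then obtain a b where ab: "a \<noteq> 0" "f a = 0" "f b = 0" "p b = a" "\<not> marked f (p a)" "a = x \<or> b = x"
      by blast
    obtain h where h: "extends f h" "piece h" "separated (p a) h" "unassigned (p a) h" "all_two_cyclic_after k h" "a \<in> range h" "b \<in> range h"
      using two_cycle_settle[OF c _ k ab(1-4)] ab(5) by auto
    obtain g where g: "extends h g" "good g" "all_two_cyclic_after (k + 2) g"
      using cascade[OF h(2-5) k(2)] by blast
    have "x \<in> range h" using ab h by blast
    then show ?thesis using g h mono extends_trans by blast
  qed
qed

text \<open>The first 2-cycle joins \<open>1\<close> with one of its children, which secures the
  first condition on controlled cycles for good.\<close>

lemma start: "\<exists>f. good f \<and> all_two_cyclic_after 2 f \<and> 1 \<in> range f \<and> f 1 \<noteq> 0 \<and> f (f 1) = 1"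
proof -
  let ?o = "\<lambda>_. 0 :: nat"
  have o: "piece ?o" by (simp add: piece_def)
  have nm: "\<not> marked ?o y" for y by (simp add: marked_def)
  have "card {v. p v = 1} \<noteq> 0" using kids[of 1] d by auto
  then obtain z where z: "p z = 1"
    by (metis (mono_tags, lifting) card.empty empty_Collect_eq)
  then have z0: "z \<noteq> 0" using p0 by (metis zero_neq_one)
  obtain h where h: "piece h" "1 \<in> range h" "h 1 = z" "h z = 1"
    and marked: "\<And>y. marked h y \<Longrightarrow> y = p 1" and new: "\<And>v. h v \<noteq> 0 \<Longrightarrow> two_cyclic_after 1 h v"
    using two_cycle_ex[OF o, of 1 z] z nm by auto
  have s: "separated 0 h" using marked noloop unfolding separated_def marked_def by metis
  have D: "all_two_cyclic_after 2 h" unfolding all_two_cyclic_after_def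
    using new two_cyclic_after_mono[of 1 h _ 2] by simp
  obtain g where g: "extends h g" "piece g" "separated 0 g" "unassigned 0 g" "all_two_cyclic_after 2 g"
    using settle[OF h(1) s D] new by auto
  have "g 1 = z" "g z = 1" using g(1) h z0 by (auto simp: extends_def)
  moreover from this have "1 \<in> range g" by (metis rangeI)
  ultimately show ?thesis using g z0 unfolding good_def by (intro exI[of _ g]) auto
qed


section \<open>Decidability of the stage invariant\<close>

lemma lookup_all: "(\<forall>v. lookup t v \<noteq> 0 \<longrightarrow> P v) \<longleftrightarrow> (\<forall>v<t. lookup t v \<noteq> 0 \<longrightarrow> P v)"
  using lookup_less by blast

lemma lookup_range: "x \<noteq> 0 \<Longrightarrow> x \<in> range (lookup t) \<longleftrightarrow> (\<exists>v<t. lookup t v = x)"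
  using lookup_less by blast

lemma piece_lookup:
  "piece (lookup t) \<longleftrightarrow> lookup t 0 = 0 \<and>
    (\<forall>v<t. lookup t v \<noteq> 0 \<longrightarrow> lookup t (lookup t v) \<noteq> 0 \<and> (lookup t v = p v \<or> p (lookup t v) = v) \<and>
       card {w. w < t \<and> lookup t w = lookup t v} = d - 1) \<and>
    (\<forall>m<t. \<forall>m'<t. lookup t m \<noteq> 0 \<longrightarrow> lookup t m' \<noteq> 0 \<longrightarrow> p m = p m' \<longrightarrow> p m \<noteq> 0 \<longrightarrow>
       \<not> (\<exists>v<t. lookup t v = p m) \<longrightarrow> m = m')"
proof -
  have fin: "finite {v. lookup t v \<noteq> 0}"
    by (rule finite_subset[of _ "{..<t}"]) (use lookup_less in blast)+
  have fiber: "{w. w < t \<and> lookup t w = lookup t v} = {w. lookup t w = lookup t v}" if "lookup t v \<noteq> 0" for v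
    using that lookup_less by fastforce
  have "(\<forall>v. lookup t v \<noteq> 0 \<longrightarrow> lookup t (lookup t v) \<noteq> 0 \<and> (lookup t v = p v \<or> p (lookup t v) = v) \<and> card {w. lookup t w = lookup t v} = d - 1)
    \<longleftrightarrow> (\<forall>v<t. lookup t v \<noteq> 0 \<longrightarrow> lookup t (lookup t v) \<noteq> 0 \<and> (lookup t v = p v \<or> p (lookup t v) = v) \<and>
       card {w. w < t \<and> lookup t w = lookup t v} = d - 1)"
    unfolding lookup_all using fiber by auto
  moreover have "(\<forall>m m'. lookup t m \<noteq> 0 \<longrightarrow> lookup t m' \<noteq> 0 \<longrightarrow> p m = p m' \<longrightarrow> p m \<noteq> 0 \<longrightarrow> p m \<notin> range (lookup t) \<longrightarrow> m = m')
    \<longleftrightarrow> (\<forall>m<t. \<forall>m'<t. lookup t m \<noteq> 0 \<longrightarrow> lookup t m' \<noteq> 0 \<longrightarrow> p m = p m' \<longrightarrow> p m \<noteq> 0 \<longrightarrow>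
       \<not> (\<exists>v<t. lookup t v = p m) \<longrightarrow> m = m')" (is "?L \<longleftrightarrow> ?R")
  proof
    assume ?L
    then show ?R using lookup_range by metis
  next
    assume R: ?R
    show ?L
    proof (intro allI impI)
      fix m m' assume *: "lookup t m \<noteq> 0" "lookup t m' \<noteq> 0" "p m = p m'" "p m \<noteq> 0" "p m \<notin> range (lookup t)"
      then have "\<not> (\<exists>v<t. lookup t v = p m)" using lookup_range by metis
      then show "m = m'" using R * lookup_less by blast
    qed
  qed
  ultimately show ?thesis unfolding piece_def using fin by blast
qed

lemma marked_lookup: "marked (lookup t) y \<longleftrightarrow> y \<noteq> 0 \<and> \<not> (\<exists>v<t. lookup t v = y) \<and> (\<exists>m<t. lookup t m \<noteq> 0 \<and> p m = y)"
  unfolding marked_def using lookup_range[of y t] lookup_less by blast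

text \<open>A marked vertex is the parent of an assigned one, so it can be sought among finitely
  many candidates.\<close>

lemma marked_p: "(\<forall>y. marked (lookup t) y \<longrightarrow> P y) \<longleftrightarrow> (\<forall>m<t. marked (lookup t) (p m) \<longrightarrow> P (p m))"
  using marked_lookup by metis

lemma good_lookup: "good (lookup t) \<longleftrightarrow> piece (lookup t) \<and>
  (\<forall>m<t. marked (lookup t) (p m) \<longrightarrow> \<not> marked (lookup t) (p (p m))) \<and> (\<forall>m<t. marked (lookup t) (p m) \<longrightarrow> lookup t (p m) = 0)"
proof -
  have "\<not> marked (lookup t) 0" by (simp add: marked_def)
  then have "separated 0 (lookup t) \<longleftrightarrow> (\<forall>y. marked (lookup t) y \<longrightarrow> \<not> marked (lookup t) (p y))"
    unfolding separated_def by metis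
  moreover from \<open>\<not> marked (lookup t) 0\<close> have "unassigned 0 (lookup t) \<longleftrightarrow> (\<forall>y. marked (lookup t) y \<longrightarrow> lookup t y = 0)"
    unfolding unassigned_def by metis
  ultimately show ?thesis unfolding good_def by (simp only: marked_p)
qed

text \<open>Stage \<open>n\<close> treats the numbers up to \<open>n + 1\<close>. So
  \<open>n\<close> itself is treated by stage \<open>n - 1\<close>, within
  \<open>2 * (n - 1) + 2 = 2 * n\<close> steps, exactly the bound for controlled cycles.\<close>

definition stage :: "nat \<Rightarrow> (nat \<Rightarrow> nat) \<Rightarrow> bool" where
  "stage n f \<longleftrightarrow> good f \<and> all_two_cyclic_after (2 * n + 2) f \<and> f 1 \<noteq> 0 \<and> f (f 1) = 1 \<and>
    (\<forall>v<n + 2. v \<noteq> 0 \<longrightarrow> v \<in> range f)"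

lemma decidable_stage:
  assumes "computable p"
  shows "decidable (\<lambda>e. stage (pfst e) (lookup (psnd e)))"
proof -
  note computable_p_intros = computable_intros computable_comp[OF assms]
  have marked: "decidable (\<lambda>e. marked (lookup (a e)) (b e))" if "computable a" "computable b" for a b
    unfolding marked_lookup by (assumption | rule that computable_p_intros computable_comp[OF that(1)] computable_comp[OF that(2)])+
  have piece: "decidable (\<lambda>e. piece (lookup (psnd e)))"
    unfolding piece_lookup by (rule computable_p_intros)+
  have R: "(v \<noteq> 0 \<longrightarrow> v \<in> range (lookup t)) \<longleftrightarrow> (v \<noteq> 0 \<longrightarrow> (\<exists>w<t. lookup t w = v))" for v t
    using lookup_range by blast
  have "stage n (lookup t) \<longleftrightarrow> good (lookup t) \<and> (\<forall>v<t. lookup t v \<noteq> 0 \<longrightarrow> (lookup t ^^ (2 * n + 2 + 2)) v = (lookup t ^^ (2 * n + 2)) v) \<and>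
    lookup t 1 \<noteq> 0 \<and> lookup t (lookup t 1) = 1 \<and> (\<forall>v<n + 2. v \<noteq> 0 \<longrightarrow> (\<exists>w<t. lookup t w = v))" for n t
    unfolding stage_def all_two_cyclic_after_def two_cyclic_after_def lookup_all R by (rule refl)
  then show ?thesis
    unfolding good_lookup by (simp only:) (rule computable_p_intros marked piece)+
qed

section \<open>The limit function and its cycles\<close>

theorem controlled_function:
  assumes "computable p"
  shows "\<exists>f. computable f \<and> (\<forall>v\<ge>1. f v \<ge> 1 \<and> (f v = p v \<or> p (f v) = v)) \<and>
    (\<forall>u\<ge>1. finite {v. 1 \<le> v \<and> f v = u} \<and> card {v. 1 \<le> v \<and> f v = u} = d - 1) \<and> controlled_cycles f"
proof -
  obtain f0 where f0: "good f0" "all_two_cyclic_after 2 f0" "1 \<in> range f0" "f0 1 \<noteq> 0" "f0 (f0 1) = 1"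
    using start by blast
  have total: "f v \<noteq> 0" if "stage n f" "0 < v" "v \<le> n + 1" for n f v
  proof -
    have "v \<in> range f" "piece f" using that by (auto simp: stage_def good_def)
    then show ?thesis using piece_range that(2) by (metis neq0_conv)
  qed
  have "\<exists>\<phi> F. computable \<phi> \<and> (\<forall>n. finite {v. F n v \<noteq> 0} \<and> stage n (F n) \<and> extends (F n) \<phi> \<and> extends (F n) (F (Suc n)))"
  proof (rule computable_limit[OF decidable_stage[OF assms]])
    have "v \<in> range f0" if "v < 0 + 2" "v \<noteq> 0" for v
    proof -
      have "v = 1" using that by simp
      then show ?thesis using f0(3) by simp
    qed
    moreover have "all_two_cyclic_after (2 * 0 + 2) f0" using f0(2) by (simp add: numeral_2_eq_2)
    ultimately show "stage 0 f0" unfolding stage_def using f0 by blast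
    show "finite {v. f0 v \<noteq> 0}" using f0 piece_fin by (auto simp: good_def)
    show "\<exists>g. finite {v. g v \<noteq> 0} \<and> extends f g \<and> stage (Suc n) g" if "stage n f" for n f
    proof -
      have f: "good f" "all_two_cyclic_after (2 * n + 2) f" "f 1 \<noteq> 0" "f (f 1) = 1" "\<forall>v<n + 2. v \<noteq> 0 \<longrightarrow> v \<in> range f"
        using that unfolding stage_def by blast+
      obtain g where g: "extends f g" "good g" "all_two_cyclic_after (2 * n + 2 + 2) g" "n + 2 \<in> range g"
        using extend[OF f(1,2), of "n + 2"] by auto
      have c: "piece f" "piece g" using f g by (auto simp: good_def)
      have "v \<in> range g" if "v < n + 3" "v \<noteq> 0" for v
        using that f(5) g(4) range_extends[OF c(1) g(1) core_0[OF c(2)], of v]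
          by (cases "v = n + 2") auto
      moreover have "g 1 = f 1" "g (g 1) = 1" using f g(1) by (auto simp: extends_def)
      ultimately have "stage (Suc n) g" using g f unfolding stage_def by auto
      then show ?thesis using g(1) piece_fin[OF c(2)] by blast
    qed
    show "f v \<noteq> 0" if "stage n f" "0 < v" "v \<le> n" for n f v
      using total[OF that(1,2)] that(3) by simp
    show "f 0 = 0" if "stage n f" for n f using that core_0 by (simp add: stage_def good_def)
  qed
  then obtain \<phi> F where \<phi>: "computable \<phi>" and F: "\<And>n. stage n (F n)" "\<And>n. extends (F n) \<phi>" "\<And>n. extends (F n) (F (Suc n))"
    by blast
  have c: "piece (F n)" for n using F(1)[of n] by (simp add: stage_def good_def)
  have nz: "F n v \<noteq> 0" if "0 < v" "v \<le> n + 1" for n v using total[OF F(1) that] .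
  have eq: "\<phi> v = F n v" if "F n v \<noteq> 0" for n v using F(2)[of n] that
    by (simp add: extends_def)
  have edge: "\<phi> v \<ge> 1 \<and> (\<phi> v = p v \<or> p (\<phi> v) = v)" if "v \<ge> 1" for v
  proof -
    have v: "F v v \<noteq> 0" using nz that by simp
    then show ?thesis using eq[OF v] piece_edge[OF c v] by simp
  qed
  have fiber: "finite {v. 1 \<le> v \<and> \<phi> v = u} \<and> card {v. 1 \<le> v \<and> \<phi> v = u} = d - 1" if u: "u \<ge> 1" for u
  proof -
    have fib: "card {v. F n v = u} = d - 1" "finite {v. F n v = u}" if "u \<le> n" for n
    proof -
      have "u \<in> range (F n)" using F(1)[of n] u that by (simp add: stage_def)
      then obtain v where "F n v = u" by blast
      then show "card {v. F n v = u} = d - 1" using piece_card[OF c, of n v] u by simp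
      show "finite {v. F n v = u}"
        by (rule finite_subset[OF _ piece_fin[OF c[of n]]]) (use u in auto)
    qed
    \<comment> \<open>A nonempty fibre of a piece over \<open>u \<noteq> 0\<close> has exactly
      \<open>d - 1\<close> elements, so the fibre of \<open>u\<close> is final once \<open>u\<close>
      is in the range, that is, at stage \<open>u\<close>.\<close>
    have "{v. 1 \<le> v \<and> \<phi> v = u} = {v. F u v = u}"
    proof (intro set_eqI iffI)
      fix v assume "v \<in> {v. 1 \<le> v \<and> \<phi> v = u}"
      then have v: "1 \<le> v" "\<phi> v = u" by auto
      have E: "extends (F u) (F (u + k))" for k by (induction k) (auto intro: extends_trans F(3))
      have "{w. F u w = u} \<subseteq> {w. F (u + v) w = u}" using E[of v] u
        by (auto simp: extends_def)
      then have "{w. F u w = u} = {w. F (u + v) w = u}"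
        using fib[of u] fib[of "u + v"] by (intro card_subset_eq) auto
      moreover have "F (u + v) v = u" using eq[of "u + v" v] nz[of v "u + v"] v by simp
      ultimately show "v \<in> {v. F u v = u}" by blast
    next
      fix v assume "v \<in> {v. F u v = u}"
      then have "F u v = u" by simp
      then have "F u v \<noteq> 0" using u by simp
      moreover from this have "v \<noteq> 0" using core_0[OF c] by metis
      ultimately show "v \<in> {v. 1 \<le> v \<and> \<phi> v = u}"
        using eq[of u v] \<open>F u v = u\<close> by simp
    qed
    then show ?thesis using fib[of u] by simp
  qed
  have cyc: "two_cyclic_after (2 * n) \<phi> n" if "n \<ge> 1" for n
  proof -
    have n: "F (n - 1) n \<noteq> 0" using nz that by simp
    have "all_two_cyclic_after (2 * (n - 1) + 2) (F (n - 1))" using F(1)[of "n - 1"]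
      by (simp add: stage_def)
    moreover have "2 * (n - 1) + 2 = 2 * n" using that by simp
    ultimately have "two_cyclic_after (2 * n) (F (n - 1)) n" using n
      by (simp add: all_two_cyclic_after_def)
    then show ?thesis using two_cyclic_after_extends[OF c F(2) n] by blast
  qed
  have "controlled_cycles \<phi>"
    unfolding controlled_cycles_def
  proof (intro conjI allI impI)
    have "F 0 1 \<noteq> 0" "F 0 (F 0 1) = 1" using F(1)[of 0] by (auto simp: stage_def)
    then show "(\<phi> ^^ 2) 1 = 1" using eq[of 0 1] eq[of 0 "F 0 1"] by (simp add: numeral_2_eq_2)
  next
    fix n :: nat assume n: "n \<ge> 2" and "periodic_point \<phi> n"
    then obtain i where i: "i \<ge> 1" "(\<phi> ^^ i) n = n" by (auto simp: periodic_point_def)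
    \<comment> \<open>Going round often enough passes the \<open>2 * n\<close> steps after which the
      orbit has period two, and ends at \<open>n\<close>; so \<open>n\<close> itself returns after
      two steps.\<close>
    have per: "(\<phi> ^^ (i * m)) n = n" for m
    proof (induction m)
      case (Suc m)
      have "(\<phi> ^^ (i * Suc m)) n = (\<phi> ^^ i) ((\<phi> ^^ (i * m)) n)"
        by (simp add: funpow_add)
      then show ?case using Suc i(2) by simp
    qed simp
    have "two_cyclic_after (i * (2 * n)) \<phi> n"
      using two_cyclic_after_mono[OF cyc[of n], of "i * (2 * n)"] n i by simp
    moreover have "(\<phi> ^^ (i * (2 * n) + 2)) n = (\<phi> ^^ 2) ((\<phi> ^^ (i * (2 * n))) n)"
      unfolding add.commute[of _ 2] funpow_add by simp
    ultimately have "(\<phi> ^^ 2) n = n" using per[of "2 * n"] by (simp only: two_cyclic_after_def)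
    then have "cycle_length \<phi> n \<le> 2" unfolding cycle_length_def by (intro Least_le) auto
    then show "cycle_length \<phi> n \<le> n" using n by simp
  next
    fix n :: nat assume n: "n \<ge> 2"
    have "(\<phi> ^^ (2 * n + 2)) n = (\<phi> ^^ (2 * n)) n" using cyc[of n] n
      by (simp add: two_cyclic_after_def)
    then show "\<exists>k l. k \<le> 2 * n \<and> 1 \<le> l \<and> l \<le> n \<and> (\<phi> ^^ (k + l)) n = (\<phi> ^^ k) n"
      using n by (intro exI[of _ "2 * n"] exI[of _ 2]) auto
  qed
  then show ?thesis using \<phi> edge fiber by blast
qed

end

subsection \<open>The matching\<close>

lemma decidable_computable_rel:
  assumes "computable_rel R" "computable a" "computable b"
  shows "decidable (\<lambda>e. (a e, b e) \<in> R)"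
proof -
  obtain g where g: "recursive_fn 2 g" "\<forall>x y. g [x, y] = (if (x, y) \<in> R then 1 else 0)"
    using assms(1) unfolding computable_rel_def by blast
  have "tuple_computable 2 (\<lambda>xs. if (xs ! 0, xs ! 1) \<in> R then 1 else 0)"
    unfolding tuple_computable_def using g
      by (auto simp: numeral_2_eq_2 length_Suc_conv intro!: exI[of _ g])
  then show ?thesis unfolding decidable_def by (rule computable_tuple2) (use assms in auto)
qed

lemma computable_rel_decidable:
  assumes "decidable (\<lambda>e. (pfst e, psnd e) \<in> R)"
  shows "computable_rel R"
proof -
  have "tuple_computable 2 (\<lambda>xs. if (xs ! 0, xs ! 1) \<in> R then 1 else 0)"
    using tuple2_computable[where F = "\<lambda>x y. if (x, y) \<in> R then 1 else 0"] assms
      by (simp add: decidable_def)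
  then obtain g where "recursive_fn 2 g"
    "\<And>xs. length xs = 2 \<Longrightarrow> g xs = (if (xs ! 0, xs ! 1) \<in> R then 1 else 0)"
    unfolding tuple_computable_def by blast
  then show ?thesis unfolding computable_rel_def by (intro exI[of _ g]) simp
qed

text \<open>A bound on the neighbours of one vertex is found by counting: it is large enough once as
  many neighbours lie below it as the degree says.\<close>

lemma computable_nbhd_bound:
  assumes E: "computable_rel E" and deg: "computable_on {1..} (\<lambda>u. card {v. (u, v) \<in> E})"
    and fin: "\<And>u. finite {v. (u, v) \<in> E}" and pos: "\<And>u v. (u, v) \<in> E \<Longrightarrow> u \<noteq> 0"
  shows "\<exists>b. computable b \<and> (\<forall>w. w \<le> b w) \<and> (\<forall>x w v. x \<le> w \<longrightarrow> (x, v) \<in> E \<longrightarrow> v \<le> b w)"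
proof -
  obtain g where g: "recursive_fn 1 g" "\<forall>u\<in>{1..}. card {v. (u, v) \<in> E} = g [u]"
    using deg unfolding computable_on_def by blast
  define D where "D u = g [u]" for u
  have D: "computable D" "\<And>u. u \<noteq> 0 \<Longrightarrow> card {v. (u, v) \<in> E} = D u"
    using g by (auto simp: computable_iff_computable_on computable_on_def D_def)
  \<comment> \<open>At \<open>0\<close>, which is no vertex, the extended degree function is
    arbitrary; the disjunct \<open>u = 0\<close> lets the search end there.\<close>
  define r where "r u = (LEAST w. u = 0 \<or> card {v. v < w \<and> (u, v) \<in> E} = D u)" for u
  have ex: "\<exists>w. u = 0 \<or> card {v. v < w \<and> (u, v) \<in> E} = D u" for u
  proof -
    obtain w where "\<forall>v\<in>{v. (u, v) \<in> E}. v < w"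
      using fin[of u] finite_nat_set_iff_bounded by blast
    then have "{v. v < w \<and> (u, v) \<in> E} = {v. (u, v) \<in> E}" by auto
    then show ?thesis using D(2) by metis
  qed
  have "computable r" unfolding r_def
    by (rule computable_intros computable_comp[OF D(1)] decidable_computable_rel[OF E] ex)+
  have r: "v < r u" if "(u, v) \<in> E" for u v
  proof -
    have "card {v. v < r u \<and> (u, v) \<in> E} = card {v. (u, v) \<in> E}"
      using LeastI_ex[OF ex[of u]] pos[OF that] D(2) unfolding r_def by simp
    then have "{v. v < r u \<and> (u, v) \<in> E} = {v. (u, v) \<in> E}"
      using fin[of u] by (intro card_subset_eq) auto
    then show ?thesis using that by blast
  qed
  define b where "b w = w + (\<Sum>u<Suc w. r u)" for w
  have "computable b" unfolding b_def
    by (rule computable_intros computable_comp[OF \<open>computable r\<close>])+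
  moreover have "v \<le> b w" if "x \<le> w" "(x, v) \<in> E" for x w v
  proof -
    have "r x \<le> (\<Sum>u<Suc w. r u)" using that(1) by (intro member_le_sum) auto
    then show ?thesis using r[OF that(2)] unfolding b_def by linarith
  qed
  ultimately show ?thesis by (intro exI[of _ b]) (auto simp: b_def)
qed

theorem theorem4p1:
  fixes d :: nat and U V :: "nat set" and E :: "(nat \<times> nat) set"
  assumes "d \<ge> 2"
    and "U = {1..}" and "V = {1..}"
    and "bipartite_graph U V E"
    and "highly_computable U V E"
    and "\<forall>u\<in>U. (u, u) \<notin> E"
    and "fully_reflected E"
    and "cehhc d U V E"
  shows "\<exists>M f. perfect_matching (d - 1) U V E M \<and> computable_rel M \<and>
           realizes U V M f \<and>
           k_to_one (d - 1) {1..} {1..} f \<and> computable_on {1..} f \<and>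
           controlled_cycles f"
proof -
  note U = assms(2) and V = assms(3)
  have pos: "u \<noteq> 0 \<and> v \<noteq> 0" if "(u, v) \<in> E" for u v
    using that assms(4) unfolding bipartite_graph_def U V by auto
  have sym: "(v, u) \<in> E" if "(u, v) \<in> E" for u v
    using that assms(7) unfolding fully_reflected_def by blast
  have nbhd: "nbhd_U E {u} = {v. (u, v) \<in> E}" for u by (auto simp: nbhd_U_def)
  have E: "computable_rel E" and deg: "computable_on {1..} (\<lambda>u. card {v. (u, v) \<in> E})"
    using assms(5) unfolding highly_computable_def U nbhd by blast+
  have fin: "finite {v. (u, v) \<in> E}" for u
  proof (cases "u = 0")
    case True
    then have "{v. (u, v) \<in> E} = {}" using pos by blast
    then show ?thesis by simp
  next
    case False
    then show ?thesis using assms(5) unfolding highly_computable_def U nbhd by simp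
  qed
  obtain h where h: "computable_on UNIV h" "h 0 = 0"
    and expand: "\<And>X n. finite X \<Longrightarrow> X \<subseteq> U \<Longrightarrow> h n \<le> card X \<Longrightarrow>
      real n \<le> real (card (nbhd_U E X)) - real d * real (card X)"
    using assms(8) unfolding cehhc_def by metis
  obtain b where b: "computable b" "\<forall>w. w \<le> b w" "\<forall>x w v. x \<le> w \<longrightarrow> (x, v) \<in> E \<longrightarrow> v \<le> b w"
    using computable_nbhd_bound[OF E deg fin] pos by blast
  interpret harem E d h b
  proof
    fix X :: "nat set" and n :: nat assume X: "finite X" "0 \<notin> X" "h n \<le> card X"
    then have "X \<subseteq> U" unfolding U by (auto simp: Suc_le_eq intro: gr0I)
    then have "real (n + d * card X) \<le> real (card (nbhd_U E X))" using expand[OF X(1) _ X(3)]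
      by simp
    moreover have "nbhd_U E X = nbs (\<lambda>u. {v. (u, v) \<in> E}) X"
      by (auto simp: nbhd_U_def nbs_def)
    ultimately show "n + d * card X \<le> card (nbs (\<lambda>u. {v. (u, v) \<in> E}) X)"
      unfolding of_nat_le_iff by simp
  qed (use sym pos fin h(2) b in blast)+
  obtain p where p: "computable p" "p 0 = 0" "\<And>v. p v \<noteq> 0 \<Longrightarrow> (p v, v) \<in> E" "\<And>u. u \<noteq> 0 \<Longrightarrow> card {v. p v = u} = d"
    using computable_parents[OF _ b(1) decidable_computable_rel[OF E]] h(1) assms(1)
    by (auto simp: computable_iff_computable_on)
  have "p v \<noteq> v" if "v \<noteq> 0" for v
    using p(3)[of v] assms(6) that unfolding U by force
  then interpret parents p d using p assms(1) by unfold_locales auto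
  obtain f where f: "computable f" "\<forall>v\<ge>1. f v \<ge> 1 \<and> (f v = p v \<or> p (f v) = v)"
    "\<forall>u\<ge>1. finite {v. 1 \<le> v \<and> f v = u} \<and> card {v. 1 \<le> v \<and> f v = u} = d - 1" "controlled_cycles f"
    using controlled_function[OF p(1)] by blast
  define M where "M = {(f v, v) | v. 1 \<le> v}"
  \<comment> \<open>If \<open>f v\<close> is a child of \<open>v\<close>, the edge known from
    \<open>p\<close> is \<open>(v, f v)\<close>, which reflection turns round.\<close>
  have "(f v, v) \<in> E" if "1 \<le> v" for v
  proof -
    have *: "f v \<noteq> 0" "v \<noteq> 0" "f v = p v \<or> p (f v) = v" using f(2) that by auto
    then show ?thesis using p(3)[of v] p(3)[of "f v"] sym by metis
  qed
  then have "M \<subseteq> E" by (auto simp: M_def)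
  moreover have "{v \<in> V. (u, v) \<in> M} = {v. 1 \<le> v \<and> f v = u}" for u
    by (auto simp: M_def V)
  moreover have "\<exists>!u. u \<in> U \<and> (u, v) \<in> M" if "v \<in> V" for v
    using that f(2) by (intro ex1I[of _ "f v"]) (auto simp: M_def U V)
  ultimately have "perfect_matching (d - 1) U V E M"
    using f(3) unfolding perfect_matching_def U by simp
  moreover have "computable_rel M"
  proof (rule computable_rel_decidable)
    have "decidable (\<lambda>e. 1 \<le> psnd e \<and> pfst e = f (psnd e))"
      by (rule computable_intros computable_comp[OF f(1)])+
    moreover have "((pfst e, psnd e) \<in> M) = (1 \<le> psnd e \<and> pfst e = f (psnd e))" for e
      by (auto simp: M_def)
    ultimately show "decidable (\<lambda>e. (pfst e, psnd e) \<in> M)" by simp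
  qed
  moreover have "realizes U V M f" by (auto simp: realizes_def M_def V)
  moreover have "k_to_one (d - 1) {1..} {1..} f"
    using f(2,3) unfolding k_to_one_def by auto
  moreover have "computable_on {1..} f"
    using f(1) unfolding computable_iff_computable_on computable_on_def by auto
  ultimately show ?thesis using f(4) by blast
qed

end
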